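(* For every integer $k \ge 0$, $k\text{-}\mathrm{EXPTIME} = k\text{-}\mathrm{DEXPWOSPACE}$.
   Context: Let $\exp_0(x)=x$ and $\exp_{j+1}(x)=2^{\exp_j(x)}$. $k\text{-}\mathrm{EXPTIME}$ is the class of languages decided by ordinary deterministic Turing machines in time $\exp_k(n^t)$ for some constant $t$ (so $0\text{-}\mathrm{EXPTIME}=\mathrm{P}$). A write-once Turing machine is a Turing machine with a single tape, infinite in one direction, a single read/write head, and tape alphabet $\{0,1\}$ (0 = blank, 1 = marked), which may never write a blank onto a marked cell (re-marking a marked cell is allowed and has no effect). $k\text{-}\mathrm{DEXPWOSPACE}$ is the class of languages decided by deterministic write-once Turing machines using at most $\exp_k(n^t)$ tape cells on inputs of length $n$, for some constant $t$. *)

theory Defs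
  imports Main
begin

text \<open>
  Deterministic Turing machines with one tape, infinite to the right, and one read/write head.
  States and tape symbols are initial segments of the natural numbers; symbol \<open>0\<close> is the blank.
\<close>

datatype move = MoveLeft | MoveRight | Stay

record tm =
  num_states :: nat
  num_symbols :: nat
  start :: nat
  accept :: nat
  reject :: nat
  delta :: "nat \<Rightarrow> nat \<Rightarrow> nat \<times> nat \<times> move"

definition is_tm :: "tm \<Rightarrow> bool" where
  "is_tm M \<longleftrightarrow>
     start M < num_states M \<and> accept M < num_states M \<and> reject M < num_states M \<and>
     accept M \<noteq> reject M \<and> 1 \<le> num_symbols M \<and>
     (\<forall>q < num_states M. \<forall>a < num_symbols M.
        case delta M q a of (q', b, _) \<Rightarrow> q' < num_states M \<and> b < num_symbols M)"

record config =
  state :: nat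
  tape :: "nat \<Rightarrow> nat"
  head :: nat

text \<open>By truncated subtraction, moving left on the leftmost cell leaves the head where it is.\<close>

fun move_head :: "move \<Rightarrow> nat \<Rightarrow> nat" where
  "move_head MoveLeft h = h - 1"
| "move_head MoveRight h = h + 1"
| "move_head Stay h = h"

definition halted :: "tm \<Rightarrow> config \<Rightarrow> bool" where
  "halted M c \<longleftrightarrow> state c = accept M \<or> state c = reject M"

definition step :: "tm \<Rightarrow> config \<Rightarrow> config" where
  "step M c =
     (if halted M c then c
      else case delta M (state c) (tape c (head c)) of (q, b, d) \<Rightarrow>
        \<lparr>state = q, tape = (tape c)(head c := b), head = move_head d (head c)\<rparr>)"

definition init_config :: "tm \<Rightarrow> nat list \<Rightarrow> config" where
  "init_config M w =
     \<lparr>state = start M, tape = (\<lambda>i. if i < length w then w ! i else 0), head = 0\<rparr>"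

definition run :: "tm \<Rightarrow> nat list \<Rightarrow> nat \<Rightarrow> config" where
  "run M w i = (step M ^^ i) (init_config M w)"

definition accepts :: "tm \<Rightarrow> nat list \<Rightarrow> bool" where
  "accepts M w \<longleftrightarrow> (\<exists>i. state (run M w i) = accept M)"

definition rejects :: "tm \<Rightarrow> nat list \<Rightarrow> bool" where
  "rejects M w \<longleftrightarrow> (\<exists>i. state (run M w i) = reject M)"

definition halts_within :: "tm \<Rightarrow> nat list \<Rightarrow> nat \<Rightarrow> bool" where
  "halts_within M w T \<longleftrightarrow> (\<exists>i\<le>T. halted M (run M w i))"

text \<open>The cells used are those holding the input and those the head is ever on.\<close>

definition cells_used :: "tm \<Rightarrow> nat list \<Rightarrow> nat set" where
  "cells_used M w = {..<length w} \<union> range (\<lambda>i. head (run M w i))"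

definition space_within :: "tm \<Rightarrow> nat list \<Rightarrow> nat \<Rightarrow> bool" where
  "space_within M w S \<longleftrightarrow> finite (cells_used M w) \<and> card (cells_used M w) \<le> S"

text \<open>
  Languages are sets of binary words. The function \<open>enc\<close> fixes how a word is laid out on the
  initial tape.
\<close>

definition decides :: "tm \<Rightarrow> (bool list \<Rightarrow> nat list) \<Rightarrow> bool list set \<Rightarrow> bool" where
  "decides M enc L \<longleftrightarrow>
     (\<forall>x. (x \<in> L \<longrightarrow> accepts M (enc x)) \<and> (x \<notin> L \<longrightarrow> rejects M (enc x)))"

text \<open>An ordinary machine has separate symbols for the blank (\<open>0\<close>) and the two bits.\<close>

definition std_enc :: "bool list \<Rightarrow> nat list" where
  "std_enc x = map (\<lambda>b. if b then 2 else 1) x"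

definition ordinary_tm :: "tm \<Rightarrow> bool" where
  "ordinary_tm M \<longleftrightarrow> is_tm M \<and> 3 \<le> num_symbols M"

text \<open>A write-once machine has symbols \<open>0\<close> (blank) and \<open>1\<close> (marked), and never unmarks a cell.\<close>

definition write_once_tm :: "tm \<Rightarrow> bool" where
  "write_once_tm M \<longleftrightarrow>
     is_tm M \<and> num_symbols M = 2 \<and> (\<forall>q < num_states M. fst (snd (delta M q 1)) = 1)"

text \<open>
  With only a blank and a mark, writing the bits directly on the tape would make words that differ
  by trailing zeros indistinguishable. Each bit therefore occupies two cells, exactly one of which
  is marked; a blank pair ends the input. Coding the bits as \<open>10\<close> and \<open>11\<close> instead would not do:
  a word of ones would then be a solid block of marks, which a write-once machine can only scan
  like a finite automaton.
\<close>

definition wo_enc :: "bool list \<Rightarrow> nat list" where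
  "wo_enc x = concat (map (\<lambda>b. if b then [0, 1] else [1, 0]) x)"

fun exp_tower :: "nat \<Rightarrow> nat \<Rightarrow> nat" where
  "exp_tower 0 x = x"
| "exp_tower (Suc j) x = 2 ^ exp_tower j x"

text \<open>
  The resource bounds are imposed on words of length at least 2: for shorter words \<open>n ^ t\<close> does not
  grow with \<open>t\<close> (on the empty word the bound for \<open>k = 0\<close> would allow no computation step at all).
  The machine still has to decide the shorter words correctly. Since \<open>t\<close> is arbitrary, this
  amounts to imposing the bounds on all sufficiently long words.
\<close>

definition EXPTIME :: "nat \<Rightarrow> bool list set set" where
  "EXPTIME k = {L. \<exists>M t. ordinary_tm M \<and> decides M std_enc L \<and>
     (\<forall>x. 2 \<le> length x \<longrightarrow>
        halts_within M (std_enc x) (exp_tower k (length x ^ t)))}"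

definition DEXPWOSPACE :: "nat \<Rightarrow> bool list set set" where
  "DEXPWOSPACE k = {L. \<exists>M t. write_once_tm M \<and> decides M wo_enc L \<and>
     (\<forall>x. 2 \<le> length x \<longrightarrow>
        space_within M (wo_enc x) (exp_tower k (length x ^ t)))}"

end

theory Submission
  imports Defs "HOL-Library.Countable_Set"
begin

text \<open>
  A halting write-once machine never repeats a configuration, and a configuration is determined by
  its state, its head position and the number of marked cells, because the marks only accumulate.
  So in space \<open>s\<close> it runs for \<open>O(s\<^sup>2)\<close> steps, and an ordinary machine can simulate it step by step.

  Conversely, a write-once machine can write down the successive configurations of an ordinary
  machine one after the other: it copies each configuration symbol by symbol, with the change made
  by one step, and marks off what has been copied. In time \<open>T\<close> this needs \<open>O((n + T)\<^sup>2)\<close> cells.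
\<close>

section \<open>Resource bounds\<close>

text \<open>Neither simulator computes a resource bound: each runs until the simulated machine
  halts, and the quadratic loss vanishes because a fixed power of \<open>exp_tower k (n ^ t)\<close>
  is again below some \<open>exp_tower k (n ^ r)\<close> for \<open>n \<ge> 2\<close>. From
  write-once to ordinary machines the two input encodings differ; folding two cells into one makes
  them agree without a conversion pass. In the other direction the obstacle is that marks are
  permanent. Reading two cells as one gives the chain blank \<open>(0, 0)\<close>, bit
  \<open>(1, 0)\<close> or \<open>(0, 1)\<close>, used \<open>(1, 1)\<close>, which marking only
  climbs: a pair holds one bit once and is then struck out. Striking out also records how far the
  copy has got, which a finite control could not remember. The control carries only a bounded piece
  of output across the tape, so the successor configuration has to be computed by a finite
  transducer in one left-to-right pass. Symbols of an arbitrary alphabet are spelled in unary over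
  the two bits.\<close>

lemma le_exp_tower: "x \<le> exp_tower k x"
proof (induction k)
  case (Suc k)
  then show ?case using less_exp[of "exp_tower k x"] by (simp add: less_imp_le le_trans)
qed simp

lemma exp_tower_mono: "x \<le> y \<Longrightarrow> exp_tower k x \<le> exp_tower k y"
  by (induction k) auto

text \<open>Raising to the power \<open>s\<close> multiplies the exponent of the outermost 2 by
  \<open>s\<close>, and for \<open>y \<ge> 2\<close> this constant is at most
  \<open>exp_tower k y ^ s\<close>. So the claim for \<open>Suc k\<close> and \<open>s\<close>
  reduces to the one for \<open>k\<close> and \<open>Suc s\<close>, which is why \<open>s\<close> is
  generalized.\<close>

lemma exp_tower_power_le: "\<exists>r. \<forall>y\<ge>2. exp_tower k y ^ s \<le> exp_tower k (y ^ r)"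
proof (induction k arbitrary: s)
  case 0
  show ?case by auto
next
  case (Suc k)
  obtain r where r: "\<forall>y\<ge>2. exp_tower k y ^ Suc s \<le> exp_tower k (y ^ r)"
    using Suc by blast
  have "exp_tower (Suc k) y ^ s \<le> exp_tower (Suc k) (y ^ r)" if y: "2 \<le> y" for y
  proof -
    let ?e = "exp_tower k y"
    have "s \<le> 2 ^ s" by (simp add: less_imp_le)
    also have "\<dots> \<le> ?e ^ s" using le_exp_tower[of y k] y by (intro power_mono) auto
    finally have "?e * s \<le> ?e ^ Suc s" by simp
    also have "\<dots> \<le> exp_tower k (y ^ r)" using r y by blast
    finally show ?thesis by (simp add: power_mult[symmetric])
  qed
  then show ?case by blast
qed

lemma square_exp_tower_le:
  "\<exists>r. \<forall>n\<ge>2. C * (exp_tower k (n ^ t) + n) ^ 2 \<le> exp_tower k (n ^ r)"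
proof -
  obtain r where r: "\<forall>y\<ge>2. exp_tower k y ^ (C + 4) \<le> exp_tower k (y ^ r)"
    using exp_tower_power_le by blast
  have "C * (exp_tower k (n ^ t) + n) ^ 2 \<le> exp_tower k (n ^ (Suc t * r))" if n: "2 \<le> n" for n
  proof -
    \<comment> \<open>\<open>Suc t\<close> instead of \<open>t\<close> makes the base at least
      \<open>n\<close> also for \<open>t = 0\<close>, so \<open>?e\<close> absorbs the summand
      \<open>n\<close>. The constant \<open>4 * C\<close> then costs \<open>C + 2\<close> further
      factors \<open>?e \<ge> 2\<close>.\<close>
    let ?e = "exp_tower k (n ^ Suc t)"
    have n1: "n \<le> n ^ Suc t" using n by simp
    have ne: "n \<le> ?e" using n1 le_exp_tower le_trans by blast
    have "exp_tower k (n ^ t) \<le> ?e" using n by (intro exp_tower_mono) simp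
    with ne have "exp_tower k (n ^ t) + n \<le> 2 * ?e" by simp
    then have "(exp_tower k (n ^ t) + n) ^ 2 \<le> (2 * ?e) ^ 2" by (rule power_mono) simp
    then have "C * (exp_tower k (n ^ t) + n) ^ 2 \<le> (C * 4) * ?e ^ 2"
      by (simp add: power_mult_distrib)
    also have "\<dots> \<le> ?e ^ (C + 2) * ?e ^ 2"
    proof (rule mult_le_mono1)
      have "C * 4 \<le> 2 ^ (C + 2)" by (simp add: less_imp_le)
      also have "\<dots> \<le> ?e ^ (C + 2)" using ne n by (intro power_mono) auto
      finally show "C * 4 \<le> ?e ^ (C + 2)" .
    qed
    also have "?e ^ (C + 2) * ?e ^ 2 = ?e ^ (C + 4)"
      by (simp only: power_add[symmetric] add.assoc) simp
    also have "\<dots> \<le> exp_tower k ((n ^ Suc t) ^ r)" using r n n1 by (meson le_trans)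
    finally show ?thesis by (simp only: power_mult)
  qed
  then show ?thesis by blast
qed

section \<open>Machines over an arbitrary state type\<close>

definition word_tape :: "nat list \<Rightarrow> nat \<Rightarrow> nat" where
  "word_tape w = (\<lambda>i. if i < length w then w ! i else 0)"

definition gstep :: "'s set \<Rightarrow> ('s \<Rightarrow> nat \<Rightarrow> 's \<times> nat \<times> move)
    \<Rightarrow> 's \<times> (nat \<Rightarrow> nat) \<times> nat \<Rightarrow> 's \<times> (nat \<Rightarrow> nat) \<times> nat" where
  "gstep H d = (\<lambda>(s, t, h). if s \<in> H then (s, t, h)
     else case d s (t h) of (s', b, m) \<Rightarrow> (s', t(h := b), move_head m h))"

text \<open>The machines built below have structured states from datatypes. A finite set
  \<open>S\<close> closed under the transitions is all that is required to number them in
  \<open>to_tm\<close>.\<close>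

locale finite_machine =
  fixes S :: "'s set" and k :: nat and d :: "'s \<Rightarrow> nat \<Rightarrow> 's \<times> nat \<times> move"
    and s0 acc rej :: 's
  assumes finite_S: "finite S"
    and in_S: "s0 \<in> S" "acc \<in> S" "rej \<in> S"
    and acc_neq_rej: "acc \<noteq> rej"
    and k_pos: "1 \<le> k"
    and closed: "\<And>s a. s \<in> S \<Longrightarrow> a < k \<Longrightarrow> d s a \<in> S \<times> {..<k} \<times> UNIV"
begin

definition to_tm :: tm where
  "to_tm = \<lparr>num_states = card S, num_symbols = k, start = to_nat_on S s0,
     accept = to_nat_on S acc, reject = to_nat_on S rej,
     delta = (\<lambda>q a. case d (from_nat_into S q) a of (s, b, m) \<Rightarrow> (to_nat_on S s, b, m))\<rparr>"

lemma to_tm_simps [simp]: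
  "num_states to_tm = card S" "num_symbols to_tm = k" "start to_tm = to_nat_on S s0"
  "accept to_tm = to_nat_on S acc" "reject to_tm = to_nat_on S rej"
  "delta to_tm q a = (case d (from_nat_into S q) a of (s, b, m) \<Rightarrow> (to_nat_on S s, b, m))"
  by (simp_all add: to_tm_def)

lemma to_nat_on_less: "s \<in> S \<Longrightarrow> to_nat_on S s < card S"
  using bij_betwE[OF to_nat_on_finite[OF finite_S]] by auto

lemma to_nat_on_eq_iff: "s \<in> S \<Longrightarrow> s' \<in> S \<Longrightarrow> to_nat_on S s = to_nat_on S s' \<longleftrightarrow> s = s'"
  using finite_S by (simp add: countable_finite)

text \<open>On numbers outside the enumeration, \<open>from_nat_into\<close> falls back to some
  element of the nonempty set \<open>S\<close>; thus \<open>delta to_tm\<close> is well behaved at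
  every \<open>q\<close>.\<close>

lemma from_nat_into_in: "from_nat_into S q \<in> S"
  using in_S by (auto intro: from_nat_into)

lemma from_to_nat: "s \<in> S \<Longrightarrow> from_nat_into S (to_nat_on S s) = s"
  using finite_S by (simp add: countable_finite)

lemma is_tm_to_tm: "is_tm to_tm"
proof -
  have "case delta to_tm q a of (q', b, _) \<Rightarrow> q' < card S \<and> b < k" if "a < k" for q a
    using closed[OF from_nat_into_in[of q] that] by (auto simp: to_nat_on_less)
  then show ?thesis
    unfolding is_tm_def using in_S acc_neq_rej k_pos
    by (simp add: to_nat_on_less to_nat_on_eq_iff del: to_tm_simps(6))
qed

lemma write_once_to_tm:
  assumes k: "k = 2" and marked: "\<And>s. 1 \<le> fst (snd (d s 1))"
  shows "write_once_tm to_tm"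
proof -
  have "fst (snd (d s 1)) = 1" if "s \<in> S" for s
    using closed[OF that, of 1] marked[of s] k by (cases "d s 1") auto
  then have "fst (snd (delta to_tm q 1)) = 1" for q
    using from_nat_into_in by (simp add: case_prod_beta)
  moreover have "num_symbols to_tm = 2" by (rule trans[OF to_tm_simps(2) k])
  ultimately show ?thesis using is_tm_to_tm unfolding write_once_tm_def by blast
qed

text \<open>The clauses \<open>s \<in> S\<close> and \<open>t j < k\<close> are the invariant: they
  allow \<open>closed\<close> to be applied to the next step and the numbering of states to be
  inverted.\<close>

lemma run_to_tm:
  assumes "\<forall>a\<in>set w. a < k" "(gstep {acc, rej} d ^^ i) (s0, word_tape w, 0) = (s, t, h)"
  shows "run to_tm w i = \<lparr>state = to_nat_on S s, tape = t, head = h\<rparr> \<and> s \<in> S \<and> (\<forall>j. t j < k)"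
  using assms(2)
proof (induction i arbitrary: s t h)
  case 0
  then have eq: "s = s0" "t = word_tape w" "h = 0" by auto
  show ?case unfolding eq using assms(1) in_S k_pos
    by (auto simp: run_def init_config_def word_tape_def)
next
  case (Suc i)
  obtain s1 t1 h1 where 1: "(gstep {acc, rej} d ^^ i) (s0, word_tape w, 0) = (s1, t1, h1)"
    by (metis prod_cases3)
  note IH = Suc.IH[OF 1]
  have st: "gstep {acc, rej} d (s1, t1, h1) = (s, t, h)" using Suc.prems 1 by simp
  obtain s2 b m where d: "d s1 (t1 h1) = (s2, b, m)" by (metis prod_cases3)
  have cl: "s2 \<in> S" "b < k" using closed[of s1 "t1 h1"] IH d by auto
  have halt: "halted to_tm (run to_tm w i) \<longleftrightarrow> s1 \<in> {acc, rej}"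
    using IH in_S by (auto simp: halted_def to_nat_on_eq_iff)
  have "run to_tm w (Suc i) = step to_tm (run to_tm w i)" by (simp add: run_def)
  moreover have "delta to_tm (to_nat_on S s1) (t1 h1) = (to_nat_on S s2, b, m)"
    using IH d by (simp add: from_to_nat)
  ultimately show ?case
    using IH st d cl halt by (auto simp: step_def gstep_def split: if_splits)
qed

lemma state_run_to_tm:
  assumes "\<forall>a\<in>set w. a < k" "fst ((gstep {acc, rej} d ^^ i) (s0, word_tape w, 0)) = s"
  shows "state (run to_tm w i) = to_nat_on S s"
  using run_to_tm[OF assms(1)] assms(2) by (metis prod_cases3 fst_conv config.select_convs(1))

lemma head_run_to_tm:
  assumes "\<forall>a\<in>set w. a < k"
  shows "head (run to_tm w i) = snd (snd ((gstep {acc, rej} d ^^ i) (s0, word_tape w, 0)))"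
  using run_to_tm[OF assms] by (metis prod_cases3 snd_conv config.select_convs(3))

end

section \<open>Write-once space is contained in ordinary time\<close>

lemma run_Suc: "run M w (Suc i) = step M (run M w i)"
  by (simp add: run_def)

lemma run_add: "run M w (i + j) = (step M ^^ i) (run M w j)"
  by (simp add: run_def funpow_add)

lemma halted_mono:
  assumes "halted M (run M w i)" "i \<le> j" shows "run M w j = run M w i"
  using assms(2,1) by (induction rule: dec_induct) (auto simp: run_Suc step_def)

lemma write_once_tape:
  assumes M: "write_once_tm M" and w: "\<forall>a\<in>set w. a < 2"
  shows "state (run M w i) < num_states M \<and> (\<forall>p. tape (run M w i) p < 2)"
proof (induction i)
  case 0
  then show ?case using M w by (auto simp: run_def init_config_def write_once_tm_def is_tm_def)
next
  case (Suc i)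
  let ?c = "run M w i"
  have "case delta M (state ?c) (tape ?c (head ?c)) of (q', b, _) \<Rightarrow> q' < num_states M \<and> b < 2"
    using M Suc unfolding write_once_tm_def is_tm_def by metis
  then show ?case using Suc by (auto simp: run_Suc step_def split: prod.splits)
qed

lemma write_once_marked_step:
  assumes M: "write_once_tm M" and w: "\<forall>a\<in>set w. a < 2"
    and p: "tape (run M w i) p = 1"
  shows "tape (run M w (Suc i)) p = 1"
proof -
  have "fst (snd (delta M (state (run M w i)) 1)) = 1"
    using M write_once_tape[OF M w] by (auto simp: write_once_tm_def)
  then show ?thesis using p
    by (auto simp: run_Suc step_def split: prod.splits)
qed

lemma write_once_marked_mono:
  assumes "write_once_tm M" "\<forall>a\<in>set w. a < 2" "i \<le> j" "tape (run M w i) p = 1"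
  shows "tape (run M w j) p = 1"
  using assms(3,4) by (induction rule: dec_induct) (blast intro: write_once_marked_step[OF assms(1,2)])+

text \<open>Configurations of one run can differ only inside this set, so counting marks can be
  confined to it.\<close>

lemma tape_outside_cells_used:
  assumes "p \<notin> cells_used M w" shows "tape (run M w i) p = 0"
proof (induction i)
  case 0
  then show ?case using assms by (auto simp: run_def init_config_def cells_used_def)
next
  case (Suc i)
  have "p \<noteq> head (run M w i)" using assms by (auto simp: cells_used_def)
  then show ?case using Suc by (auto simp: run_Suc step_def split: prod.splits)
qed

lemma write_once_halting_time:
  assumes M: "write_once_tm M" and w: "\<forall>a\<in>set w. a < 2"
    and halts: "halted M (run M w i)" and sp: "space_within M w s"
  shows "halts_within M w (Suc s * num_states M * s)"
proof -
  define N where "N = (LEAST i. halted M (run M w i))"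
  have N: "halted M (run M w N)" using halts unfolding N_def by (rule LeastI)
  have before: "\<not> halted M (run M w j)" if "j < N" for j
    using that not_less_Least unfolding N_def by blast
  let ?U = "cells_used M w"
  have fin: "finite ?U" and card: "card ?U \<le> s" using sp by (auto simp: space_within_def)
  define mk where "mk i = {p \<in> ?U. tape (run M w i) p = 1}" for i
  define f where "f i = (card (mk i), state (run M w i), head (run M w i))" for i
  have neq: "f i \<noteq> f j" if ij: "i < j" and j: "j < N" for i j
  proof
    assume eq: "f i = f j"
    have "mk i \<subseteq> mk j"
      using write_once_marked_mono[OF M w less_imp_le[OF ij]] by (auto simp: mk_def)
    moreover have "card (mk i) = card (mk j)" using eq by (simp add: f_def)
    ultimately have mk: "mk i = mk j"
      using fin by (intro card_subset_eq) (auto simp: mk_def)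
    have "tape (run M w i) p = tape (run M w j) p" for p
    proof (cases "p \<in> ?U")
      case True
      then have "tape (run M w i) p = 1 \<longleftrightarrow> tape (run M w j) p = 1"
        using mk by (auto simp: mk_def)
      moreover have "tape (run M w i) p < 2" "tape (run M w j) p < 2"
        using write_once_tape[OF M w] by blast+
      ultimately show ?thesis by linarith
    qed (simp add: tape_outside_cells_used)
    then have "run M w i = run M w j" using eq by (auto simp: f_def intro!: config.equality)
    \<comment> \<open>Equal configurations have equal futures: \<open>N - j\<close> steps lead from
      time \<open>j\<close> to halting, hence also from the earlier time \<open>i\<close>, against
      the minimality of \<open>N\<close>.\<close>
    then have "run M w (N - j + i) = run M w (N - j + j)" unfolding run_add by simp
    then have "halted M (run M w (N - j + i))" using N j by simp
    moreover have "N - j + i < N" using ij j by simp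
    ultimately show False using before by blast
  qed
  have "inj_on f {..<N}"
  proof (rule inj_onI)
    fix i j assume "i \<in> {..<N}" "j \<in> {..<N}" "f i = f j"
    then show "i = j" using neq[of i j] neq[of j i] by (cases i j rule: linorder_cases) auto
  qed
  moreover have "f ` {..<N} \<subseteq> {..s} \<times> {..<num_states M} \<times> ?U"
  proof -
    have "card (mk i) \<le> s" for i
      using card_mono[of ?U "mk i"] fin card by (auto simp: mk_def)
    then show ?thesis using write_once_tape[OF M w] by (auto simp: f_def cells_used_def)
  qed
  ultimately have "card {..<N} \<le> card ({..s} \<times> {..<num_states M} \<times> ?U)"
    using fin by (intro card_inj_on_le) auto
  also have "\<dots> = Suc s * num_states M * card ?U" by (simp add: card_cartesian_product algebra_simps)
  also have "\<dots> \<le> Suc s * num_states M * s" using card by (intro mult_le_mono2)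
  finally show ?thesis using N unfolding halts_within_def by auto
qed

section \<open>Folding the write-once tape onto an ordinary one\<close>

datatype fstate = Fresh | FAcc | FRej | FRun nat bool

text \<open>The parity of the head position is dropped on halting, because a machine has a single
  accepting and a single rejecting state.\<close>

definition fstate_of :: "tm \<Rightarrow> nat \<Rightarrow> bool \<Rightarrow> fstate" where
  "fstate_of M q par = (if q = accept M then FAcc else if q = reject M then FRej else FRun q par)"

text \<open>
  Two cells of the write-once tape are folded into one cell: \<open>a mod 2\<close> is the left cell,
  \<open>a div 2 mod 2\<close> the right one, and \<open>a div 4\<close> flags the leftmost cell, where a left move has no
  effect. On the input this takes \<open>wo_enc\<close> to \<open>std_enc\<close>, up to the flag set in the first step.
\<close>

fun fold_delta :: "tm \<Rightarrow> fstate \<Rightarrow> nat \<Rightarrow> fstate \<times> nat \<times> move" where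
  "fold_delta M Fresh a = (fstate_of M (start M) False, a mod 4 + 4, Stay)"
| "fold_delta M (FRun q False) a =
    (case delta M q (a mod 2) of (q', b, m) \<Rightarrow>
      let a' = b + 2 * (a div 2 mod 2) + 4 * (a div 4) in
      case m of
        Stay \<Rightarrow> (fstate_of M q' False, a', Stay)
      | MoveRight \<Rightarrow> (fstate_of M q' True, a', Stay)
      | MoveLeft \<Rightarrow> if 4 \<le> a then (fstate_of M q' False, a', Stay)
                   else (fstate_of M q' True, a', MoveLeft))"
| "fold_delta M (FRun q True) a =
    (case delta M q (a div 2 mod 2) of (q', b, m) \<Rightarrow>
      let a' = a mod 2 + 2 * b + 4 * (a div 4) in
      case m of
        Stay \<Rightarrow> (fstate_of M q' True, a', Stay)
      | MoveRight \<Rightarrow> (fstate_of M q' False, a', MoveRight)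
      | MoveLeft \<Rightarrow> (fstate_of M q' False, a', Stay))"
| "fold_delta M FAcc a = (FAcc, a, Stay)"
| "fold_delta M FRej a = (FRej, a, Stay)"

definition fold_tape :: "(nat \<Rightarrow> nat) \<Rightarrow> nat \<Rightarrow> nat" where
  "fold_tape t = (\<lambda>i. t (2 * i) + 2 * t (2 * i + 1) + 4 * (if i = 0 then 1 else 0))"

lemma fold_tape_upd_even:
  "fold_tape (t(2 * h := b)) =
    (fold_tape t)(h := b + 2 * t (2 * h + 1) + 4 * (if h = 0 then 1 else 0))"
  by (auto simp: fold_tape_def fun_eq_iff)

lemma fold_tape_upd_odd:
  "fold_tape (t(2 * h + 1 := b)) =
    (fold_tape t)(h := t (2 * h) + 2 * b + 4 * (if h = 0 then 1 else 0))"
proof -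
  have "2 * i \<noteq> Suc (2 * h)" for i by presburger
  then show ?thesis by (auto simp: fold_tape_def fun_eq_iff)
qed

definition fold_config :: "tm \<Rightarrow> config \<Rightarrow> fstate \<times> (nat \<Rightarrow> nat) \<times> nat" where
  "fold_config M c = (fstate_of M (state c) (odd (head c)), fold_tape (tape c), head c div 2)"

text \<open>The simulation is in lockstep: a move between the two cells of a pair changes only the
  parity in the state, and a move between pairs is a single move of the folded head.\<close>

lemma fold_config_step:
  assumes lt: "\<And>p. tape c p < 2"
  shows "gstep {FAcc, FRej} (fold_delta M) (fold_config M c) = fold_config M (step M c)"
proof (cases "halted M c")
  case True
  then show ?thesis by (auto simp: gstep_def fold_config_def step_def halted_def fstate_of_def)
next
  case False
  obtain q b m where d: "delta M (state c) (tape c (head c)) = (q, b, m)" by (metis prod_cases3)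
  define h where "h = head c div 2"
  define x where "x = tape c (2 * h)"
  define y where "y = tape c (2 * h + 1)"
  define z where "z = (if h = 0 then 1 else 0 :: nat)"
  have xy: "x < 2" "y < 2" "z < 2" using lt by (auto simp: x_def y_def z_def)
  \<comment> \<open>The folded symbol under the head. Its three digits are binary, so
    \<open>div\<close> and \<open>mod\<close> recover them, and \<open>4 \<le> v\<close> tests for
    the left end of the tape.\<close>
  define v where "v = x + 2 * y + 4 * z"
  have mods: "v mod 2 = x" "v div 2 mod 2 = y" "v div 4 = z" "4 \<le> v \<longleftrightarrow> h = 0"
    using xy by (auto simp: v_def z_def less_2_cases_iff)
  have rd: "fold_tape (tape c) h = v"
    by (simp add: fold_tape_def v_def x_def y_def z_def)
  have ns: "fstate_of M (state c) p = FRun (state c) p" for p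
    using False by (auto simp: halted_def fstate_of_def)
  have st: "step M c = \<lparr>state = q, tape = (tape c)(head c := b), head = move_head m (head c)\<rparr>"
    using False d by (simp add: step_def)
  show ?thesis
  proof (cases "odd (head c)")
    case o: True
    then have hc: "head c = 2 * h + 1" by (simp add: h_def)
    have dl: "delta M (state c) y = (q, b, m)" using d hc by (simp add: y_def)
    have "gstep {FAcc, FRej} (fold_delta M) (fold_config M c) =
        (case fold_delta M (FRun (state c) True) v of
          (s', b, m) \<Rightarrow> (s', (fold_tape (tape c))(h := b), move_head m h))"
      using o by (simp add: gstep_def fold_config_def ns rd[symmetric] h_def[symmetric])
    moreover have "fold_tape ((tape c)(head c := b)) = (fold_tape (tape c))(h := x + 2 * b + 4 * z)"
      unfolding hc fold_tape_upd_odd by (simp add: x_def z_def)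
    ultimately show ?thesis
      unfolding fold_config_def st
      by (cases m) (simp_all add: mods dl hc)
  next
    case e: False
    then have hc: "head c = 2 * h" by (simp add: h_def)
    have dl: "delta M (state c) x = (q, b, m)" using d hc by (simp add: x_def)
    have "gstep {FAcc, FRej} (fold_delta M) (fold_config M c) =
        (case fold_delta M (FRun (state c) False) v of
          (s', b, m) \<Rightarrow> (s', (fold_tape (tape c))(h := b), move_head m h))"
      using e by (simp add: gstep_def fold_config_def ns rd[symmetric] h_def[symmetric])
    moreover have "fold_tape ((tape c)(head c := b)) = (fold_tape (tape c))(h := b + 2 * y + 4 * z)"
      unfolding hc fold_tape_upd_even by (simp add: y_def z_def)
    \<comment> \<open>Only from the left cell of a pair can a left move leave the pair, or be
      truncated; hence the extra split on \<open>h\<close>.\<close>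
    ultimately show ?thesis
      unfolding fold_config_def st
      by (cases m; cases h) (simp_all add: mods dl hc Let_def)
  qed
qed


lemma halts_withinI: "halted M (run M w i) \<Longrightarrow> i \<le> T \<Longrightarrow> halts_within M w T"
  by (auto simp: halts_within_def)

lemma DEXPWOSPACE_subset_EXPTIME: "DEXPWOSPACE k \<subseteq> EXPTIME k"
proof
  fix L assume "L \<in> DEXPWOSPACE k"
  then obtain M t where M: "write_once_tm M" and dec: "decides M wo_enc L"
    and space: "\<And>x. 2 \<le> length x \<Longrightarrow> space_within M (wo_enc x) (exp_tower k (length x ^ t))"
    unfolding DEXPWOSPACE_def by blast
  define S where "S = {Fresh, FAcc, FRej} \<union> (\<lambda>(q, p). FRun q p) ` ({..<num_states M} \<times> UNIV)"
  have in_S: "fstate_of M q p \<in> S" if "q < num_states M" for q p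
    using that by (auto simp: fstate_of_def S_def)
  have dM: "q' < num_states M \<and> b < 2"
    if "delta M q a = (q', b, m)" "q < num_states M" "a < 2" for q a q' b m
    using M that unfolding write_once_tm_def is_tm_def by (metis (no_types, lifting) case_prod_conv)
  \<comment> \<open>Eight symbols: two binary cells and the flag.\<close>
  interpret fm: finite_machine S 8 "fold_delta M" Fresh FAcc FRej
  proof
    fix s a assume s: "s \<in> S" and a: "a < (8::nat)"
    have a4: "a div 4 < 2" "a div 2 mod 2 < 2" "a mod 2 < 2" using a by auto
    have bd: "x + 2 * y + 4 * z < 8" if "x < 2" "y < 2" "z < 2" for x y z :: nat
      using that by linarith
    consider "s = Fresh" | "s = FAcc" | "s = FRej" | q p where "s = FRun q p" "q < num_states M"
      using s by (auto simp: S_def)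
    then show "fold_delta M s a \<in> S \<times> {..<8} \<times> UNIV"
    proof cases
      case 1
      then show ?thesis using M by (auto simp: in_S write_once_tm_def is_tm_def)
    next
      case 4
      obtain q' b m where d: "delta M q (if p then a div 2 mod 2 else a mod 2) = (q', b, m)"
        by (metis prod_cases3)
      have "q' < num_states M" "b < 2" using dM[OF d] 4 a4 by auto
      then show ?thesis using 4 d a4
        by (cases p; cases m) (auto simp: Let_def in_S intro!: bd simp del: One_nat_def)
    qed (use a in \<open>auto simp: S_def\<close>)
  qed (auto simp: S_def)
  let ?M = fm.to_tm
  have ord: "ordinary_tm ?M" using fm.is_tm_to_tm by (simp add: ordinary_tm_def)
  have wo2: "\<forall>a\<in>set (wo_enc x). a < 2" for x
    by (auto simp: wo_enc_def split: if_splits)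
  have std8: "\<forall>a\<in>set (std_enc x). a < 8" for x
    by (auto simp: std_enc_def)
  let ?step = "gstep {FAcc, FRej} (fold_delta M)"
  \<comment> \<open>With the low digit first, \<open>[1, 0]\<close> folds to 1 and
    \<open>[0, 1]\<close> to 2, the symbols that \<open>std_enc\<close> uses.\<close>
  have enc: "wo_enc x ! (2 * i) + 2 * wo_enc x ! Suc (2 * i) = std_enc x ! i" if "i < length x" for x i
    using that
  proof (induction x arbitrary: i)
    case (Cons b x)
    then show ?case by (cases i) (auto simp: wo_enc_def std_enc_def)
  qed simp
  have len: "length (wo_enc x) = 2 * length x" "length (std_enc x) = length x" for x
    by (induction x) (auto simp: wo_enc_def std_enc_def)
  have first: "?step (Fresh, word_tape (std_enc x), 0) = fold_config M (run M (wo_enc x) 0)" for x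
  proof -
    have "word_tape (std_enc x) i < 4" for i
      by (auto simp: word_tape_def std_enc_def)
    moreover have "fold_tape (word_tape (wo_enc x)) i =
        word_tape (std_enc x) i + 4 * (if i = 0 then 1 else 0)" for i
      using enc[of i x] by (auto simp: fold_tape_def word_tape_def len)
    ultimately show ?thesis
      by (auto simp: gstep_def fold_config_def run_def init_config_def word_tape_def[symmetric])
  qed
  \<comment> \<open>The \<open>Fresh\<close> step is spent on setting the flag, so the simulation
    lags by one step.\<close>
  have sim: "(?step ^^ Suc i) (Fresh, word_tape (std_enc x), 0) = fold_config M (run M (wo_enc x) i)"
    for x i
  proof (induction i)
    case 0
    then show ?case using first by simp
  next
    case (Suc i)
    have "(?step ^^ Suc (Suc i)) (Fresh, word_tape (std_enc x), 0) =
        ?step (fold_config M (run M (wo_enc x) i))"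
      unfolding Suc[symmetric] by simp
    then show ?case
      using fold_config_step write_once_tape[OF M wo2] by (simp add: run_Suc)
  qed
  have st: "state (run ?M (std_enc x) (Suc i)) =
      to_nat_on S (fstate_of M (state (run M (wo_enc x) i)) (odd (head (run M (wo_enc x) i))))" for x i
    by (rule fm.state_run_to_tm[OF std8]) (simp only: sim fold_config_def fst_conv)
  have neq: "accept M \<noteq> reject M" using M by (auto simp: write_once_tm_def is_tm_def)
  have "decides ?M std_enc L"
    unfolding decides_def accepts_def rejects_def
  proof (intro allI conjI impI)
    fix x
    {
      assume "x \<in> L"
      then obtain i where "state (run M (wo_enc x) i) = accept M"
        using dec by (auto simp: decides_def accepts_def)
      then have "state (run ?M (std_enc x) (Suc i)) = accept ?M"
        unfolding st by (simp add: fstate_of_def)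
      then show "\<exists>i. state (run ?M (std_enc x) i) = accept ?M" ..
    next
      assume "x \<notin> L"
      then obtain i where "state (run M (wo_enc x) i) = reject M"
        using dec by (auto simp: decides_def rejects_def)
      then have "state (run ?M (std_enc x) (Suc i)) = reject ?M"
        unfolding st using neq by (simp add: fstate_of_def)
      then show "\<exists>i. state (run ?M (std_enc x) i) = reject ?M" ..
    }
  qed
  moreover
  \<comment> \<open>The factor \<open>num_states M\<close> comes from counting configurations; the
    extra unit pays for the \<open>Fresh\<close> step.\<close>
  obtain r where r: "\<And>n. 2 \<le> n \<Longrightarrow>
      Suc (num_states M) * (exp_tower k (n ^ t) + n) ^ 2 \<le> exp_tower k (n ^ r)"
    using square_exp_tower_le by blast
  have "halts_within ?M (std_enc x) (exp_tower k (length x ^ r))" if x: "2 \<le> length x" for x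
  proof -
    let ?s = "exp_tower k (length x ^ t)"
    obtain i where "halted M (run M (wo_enc x) i)"
      using dec by (metis accepts_def decides_def halted_def rejects_def)
    then obtain i where i: "i \<le> Suc ?s * num_states M * ?s" "halted M (run M (wo_enc x) i)"
      using write_once_halting_time[OF M wo2 _ space[OF x]] by (auto simp: halts_within_def)
    have "halted ?M (run ?M (std_enc x) (Suc i))"
      using i(2) unfolding halted_def st by (auto simp: fstate_of_def)
    moreover have "Suc i \<le> exp_tower k (length x ^ r)"
    proof -
      have "Suc ?s * ?s \<le> (?s + length x) ^ 2"
        unfolding power2_eq_square using x by (intro mult_le_mono) auto
      then have "num_states M * (Suc ?s * ?s) \<le> num_states M * (?s + length x) ^ 2"
        by (rule mult_le_mono2)
      moreover have "1 \<le> (?s + length x) ^ 2" using x by simp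
      ultimately have "Suc i \<le> Suc (num_states M) * (?s + length x) ^ 2"
        using i(1) by (simp add: algebra_simps)
      then show ?thesis using r[OF x] by linarith
    qed
    ultimately show ?thesis by (rule halts_withinI)
  qed
  ultimately show "L \<in> EXPTIME k" using ord unfolding EXPTIME_def by blast
qed

section \<open>Machines working on pairs of cells\<close>

lemma word_tape_nth [simp]:
  "word_tape (u @ a # v) (length u) = a" "word_tape (u @ a # b # v) (Suc (length u)) = b"
  by (auto simp: word_tape_def nth_append)

lemma word_tape_upd [simp]:
  "(word_tape (u @ a # v))(length u := b) = word_tape (u @ b # v)"
  "(word_tape (u @ c # a # v))(Suc (length u) := b) = word_tape (u @ c # b # v)"
  by (auto simp: word_tape_def nth_append fun_eq_iff nth_Cons split: nat.splits)

text \<open>This lets a list that describes the tape be lengthened when the head reaches fresh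
  cells, and lets a trailing separator be dropped.\<close>

lemma word_tape_blank [simp]: "word_tape (u @ [0]) = word_tape u"
  by (auto simp: word_tape_def nth_append fun_eq_iff)

text \<open>
  A step on the pair at cells \<open>2p\<close>, \<open>2p + 1\<close> takes four steps: read the left cell, read and write
  the right one, write the left one while moving, move once more. Writing the maximum of the old
  and the new symbol makes every such machine write-once.
\<close>

datatype 'q micro = Ready 'q | Half 'q nat | Back 'q nat move | Go 'q move

fun micro_delta :: "('q \<Rightarrow> nat \<times> nat \<Rightarrow> 'q \<times> (nat \<times> nat) \<times> move)
    \<Rightarrow> 'q micro \<Rightarrow> nat \<Rightarrow> 'q micro \<times> nat \<times> move" where
  "micro_delta D (Ready q) a = (Half q a, a, MoveRight)"
| "micro_delta D (Half q a0) a =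
    (case D q (a0, a) of (q', (b0, b1), m) \<Rightarrow> (Back q' b0 m, max a b1, MoveLeft))"
| "micro_delta D (Back q b m) a = (Go q m, max a b, m)"
| "micro_delta D (Go q m) a = (Ready q, a, m)"

definition cells :: "(nat \<times> nat) list \<Rightarrow> nat list" where
  "cells l = concat (map (\<lambda>(a, b). [a, b]) l)"

lemma cells_simps [simp]:
  "cells [] = []" "cells ((a, b) # l) = a # b # cells l" "cells (l @ l') = cells l @ cells l'"
  by (auto simp: cells_def)

lemma length_cells [simp]: "length (cells l) = 2 * length l"
  by (induction l) (auto simp: cells_def)

locale pair_machine =
  fixes D :: "'q \<Rightarrow> nat \<times> nat \<Rightarrow> 'q \<times> (nat \<times> nat) \<times> move" and qa qr :: 'q
begin

abbreviation mstep where
  "mstep \<equiv> gstep {Ready qa, Ready qr} (micro_delta D)"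

text \<open>\<open>P\<close> bounds the head in every configuration that is left, not in the last
  one, so paths compose without side conditions. The space bound is read off from
  \<open>P\<close>.\<close>

definition reach :: "nat \<Rightarrow> 'q micro \<times> (nat \<Rightarrow> nat) \<times> nat \<Rightarrow> 'q micro \<times> (nat \<Rightarrow> nat) \<times> nat \<Rightarrow> bool" where
  "reach P = (\<lambda>c c'. snd (snd c) \<le> P \<and> c' = mstep c)\<^sup>*\<^sup>*"

lemma reach_refl [simp, intro]: "reach P c c"
  by (simp add: reach_def)

lemma reach_trans [trans]: "reach P c c' \<Longrightarrow> reach P c' c'' \<Longrightarrow> reach P c c''"
  unfolding reach_def by (rule rtranclp_trans)

lemma reach_step: "mstep c = c' \<Longrightarrow> snd (snd c) \<le> P \<Longrightarrow> reach P c c'"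
  unfolding reach_def by (rule r_into_rtranclp) auto

lemma reach_funpow:
  "reach P c c' \<Longrightarrow> \<exists>n. (mstep ^^ n) c = c' \<and> (\<forall>j<n. snd (snd ((mstep ^^ j) c)) \<le> P)"
  unfolding reach_def
proof (induction rule: rtranclp_induct)
  case (step y z)
  then obtain n where "(mstep ^^ n) c = y" "\<forall>j<n. snd (snd ((mstep ^^ j) c)) \<le> P" by blast
  then have "(mstep ^^ Suc n) c = z \<and> (\<forall>j<Suc n. snd (snd ((mstep ^^ j) c)) \<le> P)"
    using step by (auto simp: less_Suc_eq)
  then show ?case by blast
qed (auto intro: exI[of _ 0])

text \<open>A zipper: \<open>ls\<close> lists the pairs to the left of the head, nearest first. Only
  configurations between two simulated pair steps are described.\<close>

definition cfg :: "'q \<Rightarrow> (nat \<times> nat) list \<Rightarrow> (nat \<times> nat) list \<Rightarrow> 'q micro \<times> (nat \<Rightarrow> nat) \<times> nat" where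
  "cfg q ls rs = (Ready q, word_tape (cells (rev ls @ rs)), 2 * length ls)"

lemma cfg_blank: "cfg q ls (rs @ [(0, 0)]) = cfg q ls rs"
  using word_tape_blank[of "cells (rev ls @ rs) @ [0]"] word_tape_blank[of "cells (rev ls @ rs)"]
  by (simp add: cfg_def)

lemma cfg_Nil: "cfg q ls [(0, 0)] = cfg q ls []"
  using cfg_blank[of q ls "[]"] by simp

text \<open>Since \<open>micro_delta\<close> writes maxima, exactly \<open>(b0, b1)\<close> is
  written when it dominates the old pair. The head leaves no cell beyond the right cell of the pair;
  the cell where it finally lands is not counted.\<close>

lemma pair_step:
  assumes q: "q \<noteq> qa" "q \<noteq> qr" and D: "D q (a0, a1) = (q', (b0, b1), m)"
    and le: "a0 \<le> b0" "a1 \<le> b1" and P: "2 * length ls + 1 \<le> P"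
  shows "reach P (cfg q ls ((a0, a1) # rs))
    (Ready q', word_tape (cells (rev ls @ (b0, b1) # rs)), move_head m (move_head m (2 * length ls)))"
proof -
  define u where "u = cells (rev ls)"
  have lu: "2 * length ls = length u" by (simp add: u_def)
  have "reach P (Ready q, word_tape (u @ a0 # a1 # cells rs), length u)
      (Half q a0, word_tape (u @ a0 # a1 # cells rs), Suc (length u))"
    using q P lu by (intro reach_step) (simp_all add: gstep_def)
  also have "reach P \<dots> (Back q' b0 m, word_tape (u @ a0 # b1 # cells rs), length u)"
    using D le P lu by (intro reach_step) (simp_all add: gstep_def max_absorb2)
  also have "reach P \<dots> (Go q' m, word_tape (u @ b0 # b1 # cells rs), move_head m (length u))"
    using le P lu by (intro reach_step) (simp_all add: gstep_def max_absorb2)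
  also have "reach P \<dots>
      (Ready q', word_tape (u @ b0 # b1 # cells rs), move_head m (move_head m (length u)))"
    using P lu by (intro reach_step) (cases m; simp add: gstep_def)+
  finally show ?thesis unfolding cfg_def lu by (simp add: u_def)
qed

lemma right_step:
  assumes "q \<noteq> qa" "q \<noteq> qr" "D q (a0, a1) = (q', (b0, b1), MoveRight)"
    "a0 \<le> b0" "a1 \<le> b1" "2 * length ls + 1 \<le> P"
  shows "reach P (cfg q ls ((a0, a1) # rs)) (cfg q' ((b0, b1) # ls) rs)"
  using pair_step[OF assms] by (simp add: cfg_def)

lemma left_step:
  assumes "q \<noteq> qa" "q \<noteq> qr" "D q (a0, a1) = (q', (b0, b1), MoveLeft)"
    "a0 \<le> b0" "a1 \<le> b1" "2 * length ls + 3 \<le> P"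
  shows "reach P (cfg q (l # ls) ((a0, a1) # rs)) (cfg q' ls (l # (b0, b1) # rs))"
  using pair_step[OF assms(1-5), of "l # ls"] assms(6) by (simp add: cfg_def)

lemma scan_right:
  assumes q: "q \<noteq> qa" "q \<noteq> qr"
  shows "(\<forall>c\<in>set cs. D q c = (q, c, MoveRight)) \<Longrightarrow> 2 * (length ls + length cs) \<le> P \<Longrightarrow>
    reach P (cfg q ls (cs @ rs)) (cfg q (rev cs @ ls) rs)"
proof (induction cs arbitrary: ls)
  case (Cons c cs)
  obtain a b where c: "c = (a, b)" by (cases c)
  have "reach P (cfg q ls (c # cs @ rs)) (cfg q (c # ls) (cs @ rs))"
    unfolding c using q Cons.prems c by (intro right_step) auto
  also have "reach P \<dots> (cfg q (rev cs @ c # ls) rs)"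
    using Cons.prems by (intro Cons.IH) auto
  finally show ?case by simp
qed simp

lemma scan_left:
  assumes q: "q \<noteq> qa" "q \<noteq> qr"
  shows "(\<forall>c\<in>set (x # cs). D q c = (q, c, MoveLeft)) \<Longrightarrow> 2 * (length ls + length cs) + 3 \<le> P \<Longrightarrow>
    reach P (cfg q (cs @ l # ls) (x # rs)) (cfg q ls (l # rev cs @ x # rs))"
proof (induction cs arbitrary: x rs)
  case Nil
  obtain a b where c: "x = (a, b)" by (cases x)
  show ?case using Nil q left_step[of q a b q a b ls P l rs] by (auto simp: c)
next
  case (Cons c cs)
  obtain a b where x: "x = (a, b)" by (cases x)
  have "reach P (cfg q (c # cs @ l # ls) (x # rs)) (cfg q (cs @ l # ls) (c # x # rs))"
    unfolding x using q Cons.prems x by (intro left_step) auto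
  also have "reach P \<dots> (cfg q ls (l # rev cs @ c # x # rs))"
    using Cons.prems by (intro Cons.IH) auto
  finally show ?case by simp
qed

end

section \<open>Iterating a sequential transducer\<close>

datatype 's pass = Read 's | Gap 's "bool list" | Write 's "bool list" | Return 's

text \<open>These are the pairs of \<open>wo_enc\<close>, so the input already is a word of the
  transducer. Each code lies strictly between blank and used, hence can be written on a blank and
  struck out later.\<close>

definition code :: "bool \<Rightarrow> nat \<times> nat" where
  "code b = (if b then (0, 1) else (1, 0))"

abbreviation (input) "blank \<equiv> (0 :: nat, 0 :: nat)"
abbreviation (input) "used \<equiv> (1 :: nat, 1 :: nat)"

text \<open>
  The tape reads \<open>used\<dots>used old blank new\<close>. A step consumes the first bit of \<open>old\<close> and appends the
  output to \<open>new\<close>; when \<open>old\<close> is exhausted, consuming the separating blank turns \<open>new\<close> into the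
  next \<open>old\<close>. The way back is recognised by the used pairs, at least one of which exists by then.
\<close>

fun pass_delta :: "('s \<Rightarrow> bool option \<Rightarrow> 's \<times> bool list)
    \<Rightarrow> 's pass \<Rightarrow> nat \<times> nat \<Rightarrow> 's pass \<times> (nat \<times> nat) \<times> move" where
  "pass_delta T (Read s) c =
    (if c = blank then case T s None of (s', ws) \<Rightarrow> (Write s' ws, used, MoveRight)
     else case T s (Some (c = code True)) of (s', ws) \<Rightarrow> (Gap s' ws, used, MoveRight))"
| "pass_delta T (Gap s ws) c = (if c = blank then Write s ws else Gap s ws, c, MoveRight)"
| "pass_delta T (Write s ws) c =
    (if c \<noteq> blank then (Write s ws, c, MoveRight)
     else case ws of [] \<Rightarrow> (Return s, c, MoveLeft) | w # ws' \<Rightarrow> (Write s ws', code w, MoveRight))"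
| "pass_delta T (Return s) c =
    (if c = used then (Read s, c, MoveRight) else (Return s, c, MoveLeft))"

lemma code_neq [simp]:
  "code b \<noteq> blank" "code b \<noteq> used" "blank \<noteq> code b" "used \<noteq> code b"
  "code b \<noteq> (Suc 0, Suc 0)" "(Suc 0, Suc 0) \<noteq> code b"
  by (auto simp: code_def)

locale transducer =
  fixes T :: "'s \<Rightarrow> bool option \<Rightarrow> 's \<times> bool list" and sa sr :: 's
begin

sublocale pair_machine "pass_delta T" "Read sa" "Read sr" .

text \<open>The counter \<open>a\<close> of consumed pairs never decreases; together with the two
  word lengths it determines the space used so far.\<close>

definition tcfg where
  "tcfg s a old new = cfg (Read s) (replicate a used) (map code old @ blank # map code new)"

lemma write_word:
  "2 * (length ls + length ws) \<le> P \<Longrightarrow>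
    reach P (cfg (Write s ws) ls []) (cfg (Write s []) (rev (map code ws) @ ls) [])"
proof (induction ws arbitrary: ls)
  case (Cons w ws)
  obtain a b where ab: "code w = (a, b)" by (cases "code w")
  \<comment> \<open>The fresh blank pair under the head is made explicit so that a pair step
    applies.\<close>
  have "reach P (cfg (Write s (w # ws)) ls [blank]) (cfg (Write s ws) ((a, b) # ls) [])"
    using Cons.prems ab by (intro right_step) auto
  also have "reach P \<dots> (cfg (Write s []) (rev (map code ws) @ code w # ls) [])"
    unfolding ab[symmetric] using Cons.prems by (intro Cons.IH) auto
  finally show ?case by (simp add: cfg_Nil)
qed simp

text \<open>The case \<open>ls = []\<close> is that of a pass with empty output: the first left move
  then already lands on a used pair and there is nothing to scan.\<close>

lemma return_to_used:
  assumes ls: "used \<notin> set ls" and P: "2 * (length ls + length us) + 3 \<le> P"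
  shows "reach P (cfg (Write s []) (ls @ used # us) []) (cfg (Read s) (used # us) (rev ls))"
proof -
  have read: "reach P (cfg (Return s) us (used # rs)) (cfg (Read s) (used # us) rs)" for rs
    using P by (intro right_step) auto
  show ?thesis
  proof (cases ls)
    case Nil
    have "reach P (cfg (Write s []) (used # us) [blank]) (cfg (Return s) us [used, blank])"
      using P by (intro left_step) auto
    also have "reach P \<dots> (cfg (Read s) (used # us) [blank])"
      by (rule read)
    finally show ?thesis using Nil by (simp add: cfg_Nil)
  next
    case (Cons l ls')
    have "reach P (cfg (Write s []) (l # ls' @ used # us) [blank])
        (cfg (Return s) (ls' @ used # us) [l, blank])"
      using P Cons by (intro left_step) auto
    also have "reach P \<dots> (cfg (Return s) us (used # rev ls' @ l # [blank]))"
      using P ls Cons by (intro scan_left) auto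
    also have "reach P \<dots> (cfg (Read s) (used # us) (rev ls' @ l # [blank]))"
      by (rule read)
    finally show ?thesis using cfg_blank[of "Read s" "used # us" "rev ls"] Cons by (simp add: cfg_Nil)
  qed
qed

lemma append_and_return:
  assumes ls: "used \<notin> set ls" and P: "2 * (length ls + length us + length new + length ws) + 3 \<le> P"
  shows "reach P (cfg (Write s ws) (ls @ used # us) (map code new))
    (cfg (Read s) (used # us) (rev ls @ map code (new @ ws)))"
proof -
  have "reach P (cfg (Write s ws) (ls @ used # us) (map code new @ []))
      (cfg (Write s ws) (rev (map code new) @ ls @ used # us) [])"
    using P by (intro scan_right) auto
  also have "reach P \<dots> (cfg (Write s []) (rev (map code ws) @ rev (map code new) @ ls @ used # us) [])"
    using P by (intro write_word) auto
  also have "\<dots> = cfg (Write s []) ((rev (map code (new @ ws)) @ ls) @ used # us) []"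
    by simp
  also have "reach P \<dots> (cfg (Read s) (used # us) (rev (rev (map code (new @ ws)) @ ls)))"
    using P ls by (intro return_to_used) auto
  finally show ?thesis by simp
qed

text \<open>The new state and the pending output travel in the control across the rest of
  \<open>old\<close>, the separator and \<open>new\<close>. The farthest cell visited is the right
  cell of the blank pair after the output, which gives the \<open>+ 3\<close>.\<close>

lemma tcfg_bit:
  assumes s: "s \<noteq> sa" "s \<noteq> sr" and T: "T s (Some b) = (s', ws)"
    and P: "2 * (a + length (b # old) + length (new @ ws)) + 3 \<le> P"
  shows "reach P (tcfg s a (b # old) new) (tcfg s' (Suc a) old (new @ ws))"
proof -
  let ?us = "replicate a used"
  obtain x y where xy: "code b = (x, y)" by (cases "code b")
  have le: "x \<le> 1" "y \<le> 1" "(x, y) \<noteq> blank" "((x, y) = code True) = b"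
    using xy by (auto simp: code_def split: if_splits)
  have "reach P (tcfg s a (b # old) new) (cfg (Gap s' ws) (used # ?us) (map code old @ blank # map code new))"
    unfolding tcfg_def list.map append_Cons xy using s T P le by (intro right_step) auto
  also have "reach P \<dots> (cfg (Gap s' ws) (rev (map code old) @ used # ?us) (blank # map code new))"
    using P by (intro scan_right) auto
  also have "reach P \<dots> (cfg (Write s' ws) ((blank # rev (map code old)) @ used # ?us) (map code new))"
    unfolding append_Cons using P by (intro right_step) auto
  also have "reach P \<dots> (cfg (Read s') (used # ?us)
      (rev (blank # rev (map code old)) @ map code (new @ ws)))"
    using P by (intro append_and_return) auto
  finally show ?thesis by (simp add: tcfg_def)
qed

text \<open>Once the separator is used up, \<open>new\<close> stands directly after the used pairs,
  and the blank beyond its end serves as the next separator.\<close>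

lemma tcfg_end:
  assumes s: "s \<noteq> sa" "s \<noteq> sr" and T: "T s None = (s', ws)"
    and P: "2 * (a + length (new @ ws)) + 3 \<le> P"
  shows "reach P (tcfg s a [] new) (tcfg s' (Suc a) (new @ ws) [])"
proof -
  let ?us = "replicate a used"
  have "reach P (tcfg s a [] new) (cfg (Write s' ws) ([] @ used # ?us) (map code new))"
    unfolding tcfg_def list.map append_Nil using s T P by (intro right_step) auto
  also have "reach P \<dots> (cfg (Read s') (used # ?us) (rev [] @ map code (new @ ws)))"
    using P by (intro append_and_return) auto
  also have "\<dots> = tcfg s' (Suc a) (new @ ws) []"
    using cfg_blank[of "Read s'" "used # ?us" "map code (new @ ws)"] by (simp add: tcfg_def)
  finally show ?thesis .
qed

end

section \<open>One step of a Turing machine as a sequential transduction\<close>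

text \<open>
  Tape symbol \<open>a\<close> is written in unary as \<open>2a\<close>, or as \<open>2a + 1\<close> under the head. A pass holds back
  one symbol, since a left move marks the cell before the one that is read.
\<close>

definition sym :: "nat \<Rightarrow> bool \<Rightarrow> nat" where
  "sym a f = 2 * a + (if f then 1 else 0)"

definition unary :: "nat \<Rightarrow> bool list" where
  "unary s = replicate s True @ [False]"

definition encode :: "nat list \<Rightarrow> bool list" where
  "encode l = concat (map unary l)"

lemma encode_simps [simp]:
  "encode [] = []" "encode (s # l) = unary s @ encode l" "encode (l @ l') = encode l @ encode l'"
  by (auto simp: encode_def)

lemma length_unary [simp]: "length (unary s) = Suc s"
  by (simp add: unary_def)

lemma length_encode_le: "\<forall>s\<in>set l. s < K \<Longrightarrow> length (encode l) \<le> K * length l"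
  by (induction l) auto

text \<open>\<open>Pre q p\<close>: the head mark has not been met and \<open>p\<close> is the
  symbol held back. \<open>Mark q\<close>: the head moved right, so the next symbol receives the
  mark. \<open>Post q\<close>: the rest is copied.\<close>

datatype phase = Pre nat "nat option" | Mark nat | Post nat

text \<open>\<open>Init f\<close> belongs to the pass over the input, \<open>f\<close> telling that
  no bit has been read; in \<open>Sim ph c\<close> the number \<open>c\<close> counts the ones of
  the current unary symbol.\<close>

datatype sim = Init bool | Sim phase nat

definition held :: "nat option \<Rightarrow> nat list" where
  "held p = (case p of None \<Rightarrow> [] | Some l \<Rightarrow> [l])"

abbreviation "plain a \<equiv> sym a False"
abbreviation "marked a \<equiv> sym a True"

lemma sym_div_mod [simp]: "sym a f div 2 = a" "even (sym a f) \<longleftrightarrow> \<not> f"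
  by (auto simp: sym_def)

text \<open>\<open>None\<close> signals the end of a configuration and resets the phase. In phase
  \<open>Mark\<close> it means that the head ran off the listed cells, so a marked blank is
  appended. A left move with nothing held back happens on the leftmost cell and keeps the mark
  there.\<close>

fun sym_step :: "tm \<Rightarrow> phase \<Rightarrow> nat option \<Rightarrow> phase \<times> nat list" where
  "sym_step M (Pre q p) (Some s) =
    (if even s then (Pre q (Some (s div 2)), map plain (held p))
     else case delta M q (s div 2) of (q', b, m) \<Rightarrow>
      (case m of
        MoveLeft \<Rightarrow> (Post q', case p of None \<Rightarrow> [marked b] | Some l \<Rightarrow> [marked l, plain b])
      | Stay \<Rightarrow> (Post q', map plain (held p) @ [marked b])
      | MoveRight \<Rightarrow> (Mark q', map plain (held p) @ [plain b])))"
| "sym_step M (Mark q) (Some s) = (Post q, [marked (s div 2)])"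
| "sym_step M (Post q) (Some s) = (Post q, [s])"
| "sym_step M (Pre q p) None = (Pre q None, [])"
| "sym_step M (Mark q) None = (Pre q None, [marked 0])"
| "sym_step M (Post q) None = (Pre q None, [])"

text \<open>If the input ends while \<open>f\<close> still holds, it is empty and its configuration
  is one marked blank. The cap on the counter keeps the state set finite; valid symbol codes stay
  below it.\<close>

fun sim_delta :: "tm \<Rightarrow> sim \<Rightarrow> bool option \<Rightarrow> sim \<times> bool list" where
  "sim_delta M (Init f) (Some b) = (Init False, unary (sym (if b then 2 else 1) f))"
| "sim_delta M (Init f) None = (Sim (Pre (start M) None) 0, if f then unary (marked 0) else [])"
| "sim_delta M (Sim ph c) (Some True) =
    (Sim ph (if Suc c < 2 * num_symbols M then Suc c else c), [])"
| "sim_delta M (Sim ph c) (Some False) =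
    (case sym_step M ph (Some c) of (ph', out) \<Rightarrow> (Sim ph' 0, encode out))"
| "sim_delta M (Sim ph c) None =
    (case sym_step M ph None of (ph', out) \<Rightarrow> (Sim ph' 0, encode out))"

fun sym_run :: "tm \<Rightarrow> phase \<Rightarrow> nat list \<Rightarrow> phase \<times> nat list" where
  "sym_run M ph [] = (ph, [])"
| "sym_run M ph (c # cs) =
    (case sym_step M ph (Some c) of (ph1, o1) \<Rightarrow>
     case sym_run M ph1 cs of (ph2, o2) \<Rightarrow> (ph2, o1 @ o2))"

lemma sym_run_append:
  "sym_run M ph (cs @ cs') =
    (case sym_run M ph cs of (ph1, o1) \<Rightarrow>
     case sym_run M ph1 cs' of (ph2, o2) \<Rightarrow> (ph2, o1 @ o2))"
  by (induction cs arbitrary: ph) (auto split: prod.splits)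

lemma sym_run_Pre:
  "sym_run M (Pre q p) (map plain u) =
    (Pre q (if u = [] then p else Some (last u)), map plain (butlast (held p @ u)))"
  by (induction u arbitrary: p) (auto simp: held_def butlast_append split: option.splits)

lemma sym_run_Post: "sym_run M (Post q) cs = (Post q, cs)"
  by (induction cs) auto

definition conf_syms :: "nat list \<Rightarrow> nat \<Rightarrow> nat list \<Rightarrow> nat list" where
  "conf_syms u a v = map plain u @ marked a # map plain v"

definition conf :: "nat \<Rightarrow> nat list \<Rightarrow> nat \<Rightarrow> nat list \<Rightarrow> config" where
  "conf q u a v = \<lparr>state = q, tape = word_tape (u @ a # v), head = length u\<rparr>"

text \<open>The tape is taken after writing \<open>b\<close>. A right move past the last listed cell
  adds a blank to the list, so configurations grow by at most one symbol per step.\<close>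

fun next_conf :: "move \<Rightarrow> nat list \<Rightarrow> nat \<Rightarrow> nat list \<Rightarrow> nat list \<times> nat \<times> nat list" where
  "next_conf Stay u b v = (u, b, v)"
| "next_conf MoveRight u b v = (u @ [b], case v of [] \<Rightarrow> (0, []) | s # v' \<Rightarrow> (s, v'))"
| "next_conf MoveLeft u b v = (if u = [] then (u, b, v) else (butlast u, last u, b # v))"

lemma step_conf:
  assumes "\<not> halted M (conf q u a v)" "delta M q a = (q', b, m)" "next_conf m u b v = (u', a', v')"
  shows "step M (conf q u a v) = conf q' u' a' v'"
proof -
  have "step M (conf q u a v) =
      \<lparr>state = q', tape = word_tape (u @ b # v), head = move_head m (length u)\<rparr>"
    using assms(1,2) by (simp add: step_def conf_def)
  then show ?thesis
    using assms(3) word_tape_blank[of "u @ [b]"]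
    by (cases m; cases u rule: rev_cases; cases v) (auto simp: conf_def)
qed

text \<open>One pass performs one machine step. The output at the end marker has to be included,
  because a head leaving the listed cells to the right appears only there.\<close>

lemma sym_run_conf:
  assumes "delta M q a = (q', b, m)" "next_conf m u b v = (u', a', v')"
    and "sym_run M (Pre q None) (conf_syms u a v) = (ph', out)"
    and "sym_step M ph' None = (ph'', out')"
  shows "ph'' = Pre q' None \<and> out @ out' = conf_syms u' a' v'"
proof -
  have snoc: "map plain (butlast w) @ plain (last w) # z = map plain w @ z" if "w \<noteq> []" for w z
    using that by (induction w) auto
  show ?thesis
    using assms
    by (cases m; cases u rule: rev_cases; cases v)
       (auto simp: conf_syms_def sym_run_append sym_run_Pre sym_run_Post held_def snoc)
qed

locale simulation =
  fixes M :: tm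
  assumes ordinary: "ordinary_tm M"
begin

sublocale transducer "sim_delta M" "Sim (Pre (accept M) None) 0" "Sim (Pre (reject M) None) 0" .

abbreviation "K \<equiv> 2 * num_symbols M"

text \<open>A halting state of \<open>M\<close> stops the simulator only in phase
  \<open>Pre\<close>, after the pass that produced it is complete; \<open>Mark\<close> and
  \<open>Post\<close> run on whatever their state.\<close>

definition active :: "phase \<Rightarrow> bool" where
  "active ph = (case ph of Pre q p \<Rightarrow> q \<noteq> accept M \<and> q \<noteq> reject M | _ \<Rightarrow> True)"

lemma active_neq:
  assumes "active ph"
  shows "Sim ph c \<noteq> Sim (Pre (accept M) None) 0" "Sim ph c \<noteq> Sim (Pre (reject M) None) 0"
  using assms by (auto simp: active_def)

lemma tcfg_ones:
  assumes ph: "active ph"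
  shows "i + j < K \<Longrightarrow> 2 * (a + j + length old + length new) + 3 \<le> P \<Longrightarrow>
    reach P (tcfg (Sim ph i) a (replicate j True @ old) new) (tcfg (Sim ph (i + j)) (a + j) old new)"
proof (induction j arbitrary: i a)
  case (Suc j)
  have "reach P (tcfg (Sim ph i) a (True # replicate j True @ old) new)
      (tcfg (Sim ph (Suc i)) (Suc a) (replicate j True @ old) (new @ []))"
    using Suc.prems active_neq[OF ph] by (intro tcfg_bit) auto
  also have "reach P \<dots> (tcfg (Sim ph (Suc i + j)) (Suc a + j) old new)"
    using Suc.prems Suc.IH[of "Suc i" "Suc a"] by simp
  finally show ?case by simp
qed simp

lemma tcfg_sym:
  assumes ph: "active ph" and c: "c < K" and s: "sym_step M ph (Some c) = (ph', out)"
    and P: "2 * (a + Suc c + length old + length (new @ encode out)) + 3 \<le> P"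
  shows "reach P (tcfg (Sim ph 0) a (unary c @ old) new)
    (tcfg (Sim ph' 0) (a + Suc c) old (new @ encode out))"
proof -
  have "reach P (tcfg (Sim ph 0) a (replicate c True @ False # old) new)
      (tcfg (Sim ph (0 + c)) (a + c) (False # old) new)"
    using c P by (intro tcfg_ones ph) auto
  also have "reach P \<dots> (tcfg (Sim ph' 0) (Suc (a + c)) old (new @ encode out))"
    using s P active_neq[OF ph] by (intro tcfg_bit) auto
  finally show ?thesis by (simp add: unary_def)
qed

lemma tcfg_syms:
  "active ph \<Longrightarrow> \<forall>c\<in>set cs. c < K \<Longrightarrow> sym_run M ph cs = (ph', out) \<Longrightarrow>
    2 * (a + length (encode cs) + length old + length (new @ encode out)) + 3 \<le> P \<Longrightarrow>
    active ph' \<and> reach P (tcfg (Sim ph 0) a (encode cs @ old) new)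
      (tcfg (Sim ph' 0) (a + length (encode cs)) old (new @ encode out))"
proof (induction cs arbitrary: ph a new out)
  case (Cons c cs)
  obtain ph1 o1 where 1: "sym_step M ph (Some c) = (ph1, o1)" by fastforce
  obtain ph2 o2 where 2: "sym_run M ph1 cs = (ph2, o2)" by fastforce
  have res: "ph2 = ph'" "out = o1 @ o2" using Cons.prems(3) 1 2 by auto
  \<comment> \<open>Before the end marker, \<open>Pre\<close> either keeps its state or turns into
    \<open>Mark\<close> or \<open>Post\<close>, which are always active.\<close>
  have "active ph1" using Cons.prems(1) 1
    by (cases ph) (auto simp: active_def split: if_splits prod.splits move.splits)
  then have IH: "active ph' \<and> reach P (tcfg (Sim ph1 0) (a + Suc c) (encode cs @ old) (new @ encode o1))
      (tcfg (Sim ph' 0) (a + Suc c + length (encode cs)) old ((new @ encode o1) @ encode o2))"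
    using Cons.prems 2 res by (intro Cons.IH) auto
  have "reach P (tcfg (Sim ph 0) a (unary c @ encode cs @ old) new)
      (tcfg (Sim ph1 0) (a + Suc c) (encode cs @ old) (new @ encode o1))"
    using Cons.prems 1 res by (intro tcfg_sym) auto
  from reach_trans[OF this conjunct2[OF IH]] show ?case using IH res by (simp add: add.assoc)
qed simp

lemma tcfg_conf:
  assumes q: "q \<noteq> accept M" "q \<noteq> reject M"
    and lt: "\<forall>c\<in>set (u @ a # v). c < num_symbols M"
    and d: "delta M q a = (q', b, m)" and nxt: "next_conf m u b v = (u', a', v')"
    and P: "2 * (p + length (encode (conf_syms u a v)) + length (encode (conf_syms u' a' v'))) + 5 \<le> P"
  shows "reach P (tcfg (Sim (Pre q None) 0) p (encode (conf_syms u a v)) [])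
    (tcfg (Sim (Pre q' None) 0) (p + length (encode (conf_syms u a v)) + 1) (encode (conf_syms u' a' v')) [])"
proof -
  let ?cs = "conf_syms u a v"
  obtain ph' out where r: "sym_run M (Pre q None) ?cs = (ph', out)" by fastforce
  obtain ph'' out' where e: "sym_step M ph' None = (ph'', out')" by fastforce
  have res: "ph'' = Pre q' None" "out @ out' = conf_syms u' a' v'"
    using sym_run_conf[OF d nxt r e] by auto
  have P': "2 * (p + length (encode ?cs) + length (encode (out @ out'))) + 5 \<le> P"
    using P by (simp only: res)
  have "\<forall>c\<in>set ?cs. c < K" using lt by (auto simp: conf_syms_def sym_def)
  then have *: "active ph' \<and> reach P (tcfg (Sim (Pre q None) 0) p (encode ?cs @ []) [])
      (tcfg (Sim ph' 0) (p + length (encode ?cs)) [] ([] @ encode out))"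
    using q P' r by (intro tcfg_syms) (auto simp: active_def)
  have "reach P (tcfg (Sim ph' 0) (p + length (encode ?cs)) [] (encode out))
      (tcfg (Sim ph'' 0) (Suc (p + length (encode ?cs))) (encode out @ encode out') [])"
    using * e P' active_neq by (intro tcfg_end) auto
  with * show ?thesis
    using reach_trans[of P] unfolding encode_simps(3)[symmetric] res by fastforce
qed

end

section \<open>Finiteness of the state set of the write-once simulator\<close>

lemma finite_machine_micro:
  assumes "finite Q" "q0 \<in> Q" "qa \<in> Q" "qr \<in> Q" "qa \<noteq> qr"
    and closed: "\<And>q c. q \<in> Q \<Longrightarrow> c \<in> {..<2} \<times> {..<2} \<Longrightarrow> D q c \<in> Q \<times> ({..<2} \<times> {..<2}) \<times> UNIV"
  shows "finite_machine (Ready ` Q \<union> (\<lambda>(q, a). Half q a) ` (Q \<times> {..<2}) \<union>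
      (\<lambda>(q, b, m). Back q b m) ` (Q \<times> {..<2} \<times> UNIV) \<union> (\<lambda>(q, m). Go q m) ` (Q \<times> UNIV))
    2 (micro_delta D) (Ready q0) (Ready qa) (Ready qr)"
    (is "finite_machine ?S _ _ _ _ _")
proof
  have "UNIV = {MoveLeft, MoveRight, Stay}" using move.exhaust by auto
  then have "finite (UNIV :: move set)" by (metis finite.simps)
  then show "finite ?S" using assms by auto
  fix s a assume s: "s \<in> ?S" and a: "a < (2::nat)"
  then consider q where "s = Ready q" "q \<in> Q" | q a0 where "s = Half q a0" "q \<in> Q" "a0 < 2"
    | q b m where "s = Back q b m" "q \<in> Q" "b < 2" | q m where "s = Go q m" "q \<in> Q"
    by auto
  then show "micro_delta D s a \<in> ?S \<times> {..<2} \<times> UNIV"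
  proof cases
    case (2 q a0)
    obtain q' b0 b1 m where "D q (a0, a) = (q', (b0, b1), m)" by (metis prod_cases3 surj_pair)
    then show ?thesis using closed[of q "(a0, a)"] 2 a by (auto simp: image_iff)
  qed (use a in \<open>auto simp: image_iff\<close>)
qed (use assms in auto)

lemma micro_delta_write_once: "1 \<le> fst (snd (micro_delta D s 1))"
  by (cases s) (auto split: prod.splits)

text \<open>The bound \<open>B\<close> on a single output of the transducer bounds all pending
  words, since \<open>Write\<close> only shortens them; so \<open>Q\<close> is finite whenever
  \<open>TS\<close> is.\<close>

lemma closed_pass_delta:
  assumes T: "\<And>s i. s \<in> TS \<Longrightarrow> fst (T s i) \<in> TS \<and> length (snd (T s i)) \<le> B"
    and Q: "Q = Read ` TS \<union> (\<lambda>(s, ws). Gap s ws) ` (TS \<times> {ws. length ws \<le> B}) \<union>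
      (\<lambda>(s, ws). Write s ws) ` (TS \<times> {ws. length ws \<le> B}) \<union> Return ` TS"
    and q: "q \<in> Q" and c: "c \<in> {..<2} \<times> {..<2}"
  shows "pass_delta T q c \<in> Q \<times> ({..<2} \<times> {..<2}) \<times> UNIV"
proof -
  consider s where "q = Read s" "s \<in> TS" | s ws where "q = Gap s ws" "s \<in> TS" "length ws \<le> B"
    | s ws where "q = Write s ws" "s \<in> TS" "length ws \<le> B" | s where "q = Return s" "s \<in> TS"
    using q unfolding Q by auto
  then show ?thesis
  proof cases
    case (1 s)
    then show ?thesis using T[of s None] T[of s "Some (c = code True)"]
      by (auto simp: Q image_iff split: prod.splits)
  next
    case (3 s ws)
    then show ?thesis using c
      by (cases ws) (auto simp: Q image_iff code_def)
  qed (use c in \<open>auto simp: Q image_iff\<close>)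
qed

context simulation
begin

definition phases :: "phase set" where
  "phases = (\<lambda>(q, p). Pre q p) ` ({..<num_states M} \<times> insert None (Some ` {..<num_symbols M})) \<union>
    Mark ` {..<num_states M} \<union> Post ` {..<num_states M}"

definition sims :: "sim set" where
  "sims = range Init \<union> (\<lambda>(ph, c). Sim ph c) ` (phases \<times> {..<K})"

lemma in_phases [simp]:
  "Pre q None \<in> phases \<longleftrightarrow> q < num_states M"
  "Pre q (Some a) \<in> phases \<longleftrightarrow> q < num_states M \<and> a < num_symbols M"
  "Mark q \<in> phases \<longleftrightarrow> q < num_states M" "Post q \<in> phases \<longleftrightarrow> q < num_states M"
  by (auto simp: phases_def)

lemma in_sims [simp]: "Init f \<in> sims" "Sim ph c \<in> sims \<longleftrightarrow> ph \<in> phases \<and> c < K"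
  by (auto simp: sims_def)

lemma finite_sims: "finite sims"
  by (auto simp: sims_def phases_def)

lemma tm_closed:
  "start M < num_states M" "accept M < num_states M" "reject M < num_states M"
  "accept M \<noteq> reject M" "3 \<le> num_symbols M"
  "q < num_states M \<Longrightarrow> a < num_symbols M \<Longrightarrow> delta M q a = (q', b, m) \<Longrightarrow>
    q' < num_states M \<and> b < num_symbols M"
  using ordinary unfolding ordinary_tm_def is_tm_def by fastforce+

lemma sym_less: "a < num_symbols M \<Longrightarrow> sym a f < K"
  by (auto simp: sym_def)

text \<open>At most two symbols leave in one step, the held one and the rewritten one, and each has
  a unary code of length at most \<open>K\<close>; hence \<open>2 * K\<close>.\<close>

lemma closed_sym_step:
  assumes ph: "ph \<in> phases" and s: "\<And>c. s = Some c \<Longrightarrow> c < K"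
    and st: "sym_step M ph s = (ph', out)"
  shows "ph' \<in> phases \<and> length (encode out) \<le> 2 * K"
proof -
  have pos: "0 < num_symbols M" using tm_closed(5) by simp
  have "ph' \<in> phases \<and> (\<forall>c\<in>set out. c < K) \<and> length out \<le> 2"
  proof (cases s)
    case None
    have "Pre q None \<in> phases" if "Pre q p \<in> phases" for q p
      using that by (auto simp: phases_def)
    then show ?thesis using None ph st sym_less[OF pos] by (cases ph) auto
  next
    case (Some c)
    have c: "c < K" "c div 2 < num_symbols M" using s[OF Some] by auto
    show ?thesis
    proof (cases ph)
      case (Pre q p)
      have q: "q < num_states M" using ph Pre by (auto simp: phases_def)
      have h: "\<forall>l\<in>set (held p). l < num_symbols M" "length (held p) \<le> 1"
        using ph Pre by (auto simp: phases_def held_def)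
      obtain q' b m where d: "delta M q (c div 2) = (q', b, m)" by (metis prod_cases3)
      note cl = tm_closed(6)[OF q c(2) d]
      show ?thesis
      proof (cases "even c")
        case True
        then have "ph' = Pre q (Some (c div 2))" "out = map plain (held p)"
          using st Pre Some by simp_all
        then show ?thesis using h q c by (auto intro!: sym_less)
      next
        case False
        then have "(ph', out) = (case m of
            MoveLeft \<Rightarrow> (Post q', case p of None \<Rightarrow> [marked b] | Some l \<Rightarrow> [marked l, plain b])
          | Stay \<Rightarrow> (Post q', map plain (held p) @ [marked b])
          | MoveRight \<Rightarrow> (Mark q', map plain (held p) @ [plain b]))"
          using st Pre Some d by simp
        then show ?thesis using h cl
          by (cases m; cases p) (simp_all add: held_def sym_less)
      qed
    qed (use st Some c ph sym_less[OF c(2)] in auto)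
  qed
  then have "ph' \<in> phases" "length (encode out) \<le> K * length out" "K * length out \<le> K * 2"
    using length_encode_le[of out K] by (auto intro: mult_le_mono2)
  then show ?thesis by linarith
qed

lemma closed_sim_delta:
  assumes "s \<in> sims"
  shows "fst (sim_delta M s i) \<in> sims \<and> length (snd (sim_delta M s i)) \<le> 2 * K"
proof (cases s)
  case (Init f)
  then show ?thesis using tm_closed(1,5)
    by (cases i) (auto simp: sym_def)
next
  case (Sim ph c)
  then have ph: "ph \<in> phases" "c < K" using assms by auto
  have fin: "fst (case sym_step M ph r of (ph', out) \<Rightarrow> (Sim ph' 0, encode out)) \<in> sims \<and>
      length (snd (case sym_step M ph r of (ph', out) \<Rightarrow> (Sim ph' 0, encode out))) \<le> 2 * K"
    if r: "\<And>d. r = Some d \<Longrightarrow> d < K" for r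
  proof -
    obtain ph' out where st: "sym_step M ph r = (ph', out)" by fastforce
    show ?thesis using closed_sym_step[OF ph(1) r st] ph(2) by (simp add: st)
  qed
  consider "i = Some True" | "i = Some False" | "i = None" by (cases i) auto
  then show ?thesis
  proof cases
    case 1
    then show ?thesis using Sim ph by simp
  next
    case 2
    then show ?thesis using fin[of "Some c"] ph Sim by simp
  next
    case 3
    then show ?thesis using fin[of None] Sim by simp
  qed
qed

section \<open>The complete simulation and its space\<close>

lemma tcfg_init:
  "2 * (a + length x + length (new @ encode (map plain (std_enc x)))) + 3 \<le> P \<Longrightarrow>
    reach P (tcfg (Init False) a x new)
      (tcfg (Init False) (a + length x) [] (new @ encode (map plain (std_enc x))))"
proof (induction x arbitrary: a new)
  case (Cons b x)
  let ?u = "unary (plain (if b then 2 else 1))"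
  have "reach P (tcfg (Init False) a (b # x) new) (tcfg (Init False) (Suc a) x (new @ ?u))"
    using Cons.prems by (intro tcfg_bit) (auto simp: std_enc_def)
  also have "reach P \<dots> (tcfg (Init False) (Suc a + length x) []
      ((new @ ?u) @ encode (map plain (std_enc x))))"
    using Cons.prems by (intro Cons.IH) (auto simp: std_enc_def)
  finally show ?case by (simp add: std_enc_def)
qed (simp add: std_enc_def)

lemma reach_start:
  assumes R: "K * (length x + 1) \<le> R" and P: "2 * (length x + 1 + R) + 5 \<le> P"
  shows "\<exists>u a v. run M (std_enc x) 0 = conf (start M) u a v \<and>
    (\<forall>s\<in>set (u @ a # v). s < num_symbols M) \<and> length u + length v \<le> length x \<and>
    reach P (tcfg (Init True) 0 x [])
      (tcfg (Sim (Pre (start M) None) 0) (length x + 1) (encode (conf_syms u a v)) [])"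
proof (cases x)
  case Nil
  have "reach P (tcfg (Init True) 0 [] [])
      (tcfg (Sim (Pre (start M) None) 0) (Suc 0) ([] @ encode (conf_syms [] 0 [])) [])"
    using P Nil tm_closed(5) by (intro tcfg_end) (auto simp: conf_syms_def sym_def)
  moreover have "run M (std_enc x) 0 = conf (start M) [] 0 []"
    using Nil word_tape_blank[of "[]"]
    by (simp add: run_def init_config_def conf_def std_enc_def) (simp add: word_tape_def)
  ultimately show ?thesis using Nil tm_closed(5) by fastforce
next
  case (Cons b y)
  define c :: nat where "c = (if b then 2 else 1)"
  let ?s = "conf_syms [] c (std_enc y)"
  have lt: "\<forall>s\<in>set (c # std_enc y). s < num_symbols M"
    using tm_closed(5) by (auto simp: std_enc_def c_def)
  then have "\<forall>s\<in>set ?s. s < K" by (auto simp: conf_syms_def intro!: sym_less)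
  then have "length (encode ?s) \<le> K * length ?s" by (rule length_encode_le)
  also have "length ?s = length x" by (simp add: conf_syms_def std_enc_def Cons)
  also have "K * length x \<le> R" using R by simp
  finally have le: "length (encode ?s) \<le> R" .
  have s: "encode ?s = unary (marked c) @ encode (map plain (std_enc y))"
    by (simp add: conf_syms_def)
  have P': "2 * (length x + 1 + length (encode ?s)) + 5 \<le> P"
    using le by (intro le_trans[OF _ P]) simp
  have "reach P (tcfg (Init True) 0 (b # y) []) (tcfg (Init False) (Suc 0) y ([] @ unary (marked c)))"
    using P' Cons s by (intro tcfg_bit) (auto simp: c_def)
  also have "reach P \<dots> (tcfg (Init False) (Suc 0 + length y) [] (([] @ unary (marked c)) @ encode (map plain (std_enc y))))"
    using P' Cons s by (intro tcfg_init) auto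
  also have "\<dots> = tcfg (Init False) (length x) [] (encode ?s)" by (simp add: Cons s)
  also have "reach P \<dots> (tcfg (Sim (Pre (start M) None) 0) (Suc (length x)) (encode ?s @ []) [])"
    using P' by (intro tcfg_end) auto
  finally have "reach P (tcfg (Init True) 0 x [])
      (tcfg (Sim (Pre (start M) None) 0) (length x + 1) (encode ?s) [])"
    by (simp add: Cons)
  moreover have "run M (std_enc x) 0 = conf (start M) [] c (std_enc y)"
    by (simp add: run_def init_config_def conf_def std_enc_def word_tape_def Cons c_def)
  moreover have "length ([] :: nat list) + length (std_enc y) \<le> length x"
    by (simp add: Cons std_enc_def)
  ultimately show ?thesis using lt append_Nil by metis
qed

text \<open>Up to time \<open>T\<close> a configuration has at most \<open>length x + T + 1\<close>
  symbols, each of code length at most \<open>K\<close>; this is \<open>R\<close>. The input and its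
  separator use up \<open>length x + 1\<close> pairs, each step at most \<open>R + 1\<close> more,
  and \<open>2 * R\<close> leaves room for the old and the new configuration side by side.\<close>

lemma reach_run:
  assumes R: "R = K * (length x + T + 1)" and P: "P = 2 * (length x + 1 + T * (R + 1) + 2 * R) + 5"
  shows "i \<le> T \<Longrightarrow> \<forall>j<i. \<not> halted M (run M (std_enc x) j) \<Longrightarrow>
    \<exists>q u a v p. run M (std_enc x) i = conf q u a v \<and> q < num_states M \<and>
      (\<forall>c\<in>set (u @ a # v). c < num_symbols M) \<and> length u + length v \<le> length x + i \<and>
      p \<le> length x + 1 + i * (R + 1) \<and>
      reach P (tcfg (Init True) 0 x []) (tcfg (Sim (Pre q None) 0) p (encode (conf_syms u a v)) [])"
proof (induction i)
  case 0
  have "K * (length x + 1) \<le> R" unfolding R by (rule mult_le_mono2) simp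
  moreover have "2 * (length x + 1 + R) + 5 \<le> P" unfolding P by simp
  ultimately obtain u a v where "run M (std_enc x) 0 = conf (start M) u a v"
    "\<forall>c\<in>set (u @ a # v). c < num_symbols M" "length u + length v \<le> length x"
    "reach P (tcfg (Init True) 0 x [])
      (tcfg (Sim (Pre (start M) None) 0) (length x + 1) (encode (conf_syms u a v)) [])"
    using reach_start by blast
  then show ?case using tm_closed(1) by (intro exI[of _ "start M"] exI[of _ u] exI[of _ a] exI[of _ v]
    exI[of _ "length x + 1"]) simp
next
  case (Suc i)
  then obtain q u a v p where c: "run M (std_enc x) i = conf q u a v" and q: "q < num_states M"
    and lt: "\<forall>c\<in>set (u @ a # v). c < num_symbols M" and len: "length u + length v \<le> length x + i"
    and p: "p \<le> length x + 1 + i * (R + 1)"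
    and re: "reach P (tcfg (Init True) 0 x []) (tcfg (Sim (Pre q None) 0) p (encode (conf_syms u a v)) [])"
    by auto
  have nh: "\<not> halted M (conf q u a v)" using Suc.prems c[symmetric] by simp
  obtain q' b m where d: "delta M q a = (q', b, m)" by (metis prod_cases3)
  obtain u' a' v' where nx: "next_conf m u b v = (u', a', v')" by (metis prod_cases3)
  have q'b: "q' < num_states M" "b < num_symbols M" using tm_closed(6)[OF q _ d] lt by auto
  have lt': "\<forall>c\<in>set (u' @ a' # v'). c < num_symbols M"
    using lt q'b nx tm_closed(5)
    by (cases m; cases u rule: rev_cases; cases v) auto
  have len': "length u' + length v' \<le> length x + Suc i"
    using nx len by (cases m; cases u rule: rev_cases; cases v) auto
  have small: "length (encode (conf_syms u a v)) \<le> R"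
    if "\<forall>c\<in>set (u @ a # v). c < num_symbols M" "length u + length v \<le> length x + T" for u a v
  proof -
    have "\<forall>c\<in>set (conf_syms u a v). c < K"
      using that by (auto simp: conf_syms_def intro!: sym_less)
    then have "length (encode (conf_syms u a v)) \<le> K * length (conf_syms u a v)"
      by (rule length_encode_le)
    also have "\<dots> \<le> R" unfolding R using that by (intro mult_le_mono2) (simp add: conf_syms_def)
    finally show ?thesis .
  qed
  have s1: "length (encode (conf_syms u a v)) \<le> R" and s2: "length (encode (conf_syms u' a' v')) \<le> R"
    using small lt lt' len len' Suc.prems(1) by auto
  have "i * (R + 1) \<le> T * (R + 1)" using Suc.prems(1) by (intro mult_le_mono1) simp
  then have "reach P (tcfg (Sim (Pre q None) 0) p (encode (conf_syms u a v)) [])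
    (tcfg (Sim (Pre q' None) 0) (p + length (encode (conf_syms u a v)) + 1) (encode (conf_syms u' a' v')) [])"
    using nh s1 s2 p by (intro tcfg_conf[OF _ _ lt d nx]) (auto simp: halted_def conf_def P)
  then have "reach P (tcfg (Init True) 0 x [])
    (tcfg (Sim (Pre q' None) 0) (p + length (encode (conf_syms u a v)) + 1) (encode (conf_syms u' a' v')) [])"
    using re reach_trans by blast
  moreover have "p + length (encode (conf_syms u a v)) + 1 \<le> length x + 1 + Suc i * (R + 1)"
    using p s1 by simp
  moreover have "run M (std_enc x) (Suc i) = conf q' u' a' v'"
    using step_conf[OF nh d nx] c by (simp add: run_Suc)
  ultimately show ?case using q'b lt' len' by blast
qed

lemma tcfg_start: "tcfg (Init True) 0 x [] = (Ready (Read (Init True)), word_tape (wo_enc x), 0)"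
proof -
  have "cells (map code x) = wo_enc x"
    by (induction x) (auto simp: wo_enc_def code_def)
  then show ?thesis
    using cfg_blank[of "Read (Init True)" "[]" "map code x"] by (simp add: tcfg_def cfg_def)
qed

lemma reach_halting:
  assumes halt: "halted M (run M (std_enc x) T)"
    and R: "R = K * (length x + T + 1)" and P: "P = 2 * (length x + 1 + T * (R + 1) + 2 * R) + 5"
  shows "\<exists>t h. reach P (Ready (Read (Init True)), word_tape (wo_enc x), 0)
    (Ready (Read (Sim (Pre (state (run M (std_enc x) T)) None) 0)), t, h) \<and> h \<le> P"
proof -
  \<comment> \<open>\<open>reach_run\<close> asks that no earlier configuration has halted, whereas
    \<open>T\<close> may lie after halting; the configurations at \<open>N\<close> and
    \<open>T\<close> coincide.\<close>
  define N where "N = (LEAST i. halted M (run M (std_enc x) i))"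
  have "halted M (run M (std_enc x) N)" unfolding N_def using halt by (rule LeastI)
  moreover have N: "N \<le> T" unfolding N_def using halt by (rule Least_le)
  ultimately have eq: "run M (std_enc x) T = run M (std_enc x) N" by (rule halted_mono)
  have "\<forall>j<N. \<not> halted M (run M (std_enc x) j)" unfolding N_def using not_less_Least by blast
  from reach_run[OF R P N this] obtain q u a v p where
    r: "run M (std_enc x) N = conf q u a v" and p: "p \<le> length x + 1 + N * (R + 1)" and
    re: "reach P (tcfg (Init True) 0 x []) (tcfg (Sim (Pre q None) 0) p (encode (conf_syms u a v)) [])"
    by blast
  have "N * (R + 1) \<le> T * (R + 1)" using N by (rule mult_le_mono1)
  then have "p \<le> length x + 1 + T * (R + 1) + 2 * R" using p by linarith
  then have "2 * p \<le> P" unfolding P by (rule trans_le_add1[OF mult_le_mono2])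
  then show ?thesis
    using re unfolding tcfg_start eq r by (auto simp: tcfg_def cfg_def conf_def)
qed

end

lemma EXPTIME_subset_DEXPWOSPACE: "EXPTIME k \<subseteq> DEXPWOSPACE k"
proof
  fix L assume "L \<in> EXPTIME k"
  then obtain M t where M: "ordinary_tm M" and dec: "decides M std_enc L"
    and time: "\<And>x. 2 \<le> length x \<Longrightarrow> halts_within M (std_enc x) (exp_tower k (length x ^ t))"
    unfolding EXPTIME_def by blast
  interpret simulation M by (rule simulation.intro[OF M])
  let ?sa = "Sim (Pre (accept M) None) 0" and ?sr = "Sim (Pre (reject M) None) 0"
  let ?W = "{ws :: bool list. length ws \<le> 2 * K}"
  define Q where "Q = Read ` sims \<union> (\<lambda>(s, ws). Gap s ws) ` (sims \<times> ?W) \<union>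
      (\<lambda>(s, ws). Write s ws) ` (sims \<times> ?W) \<union> Return ` sims"
  have "finite ?W" using finite_lists_length_le[of "UNIV :: bool set" "2 * K"] by simp
  then have "finite Q" using finite_sims by (auto simp: Q_def)
  moreover have "Read (Init True) \<in> Q" "Read ?sa \<in> Q" "Read ?sr \<in> Q" "Read ?sa \<noteq> Read ?sr"
    using tm_closed(1-5) by (auto simp: Q_def)
  moreover have "pass_delta (sim_delta M) q c \<in> Q \<times> ({..<2} \<times> {..<2}) \<times> UNIV"
    if "q \<in> Q" "c \<in> {..<2} \<times> {..<2}" for q c
    using closed_pass_delta[OF closed_sim_delta Q_def that] .
  ultimately obtain S where "finite_machine S 2 (micro_delta (pass_delta (sim_delta M)))
      (Ready (Read (Init True))) (Ready (Read ?sa)) (Ready (Read ?sr))"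
    using finite_machine_micro[of Q "Read (Init True)" "Read ?sa" "Read ?sr"] by blast
  then interpret fm: finite_machine S 2 "micro_delta (pass_delta (sim_delta M))"
    "Ready (Read (Init True))" "Ready (Read ?sa)" "Ready (Read ?sr)" .
  let ?M = fm.to_tm
  have wo: "write_once_tm ?M"
    using micro_delta_write_once by (intro fm.write_once_to_tm) simp_all
  have wo2: "\<forall>a\<in>set (wo_enc x). a < 2" for x
    by (auto simp: wo_enc_def split: if_splits)
  let ?step = "\<lambda>x i. (mstep ^^ i) (Ready (Read (Init True)), word_tape (wo_enc x), 0)"
  \<comment> \<open>\<open>cells_used\<close> ranges over all times, so the head has to be bounded
    after halting too; from then on the configuration is frozen.\<close>
  have final: "\<exists>n. fst (?step x n) = Ready (Read (Sim (Pre (state (run M (std_enc x) T)) None) 0)) \<and>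
      (\<forall>j. snd (snd (?step x j)) \<le> 2 * (length x + 1 + T * (R + 1) + 2 * R) + 5)"
    if halt: "halted M (run M (std_enc x) T)" and R: "R = K * (length x + T + 1)" for x T R
  proof -
    define P where "P = 2 * (length x + 1 + T * (R + 1) + 2 * R) + 5"
    let ?f = "Ready (Read (Sim (Pre (state (run M (std_enc x) T)) None) 0))"
    obtain t h n where n: "?step x n = (?f, t, h)" and h: "h \<le> P"
      and before: "\<forall>j<n. snd (snd (?step x j)) \<le> P"
      using reach_halting[OF halt R P_def] reach_funpow by blast
    have "mstep (?f, t, h) = (?f, t, h)"
      using halt by (auto simp: gstep_def halted_def)
    then have "(mstep ^^ i) (?f, t, h) = (?f, t, h)" for i
      by (induction i) auto
    then have "?step x (i + n) = (?f, t, h)" for i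
      unfolding funpow_add comp_def n .
    then have after: "snd (snd (?step x (i + n))) \<le> P" for i
      using h by simp
    have "snd (snd (?step x j)) \<le> P" for j
      using before after[of "j - n"] by (cases "j < n") simp_all
    moreover have "fst (?step x n) = ?f" by (simp add: n)
    ultimately show ?thesis unfolding P_def by blast
  qed
  have "decides ?M wo_enc L"
    unfolding decides_def accepts_def rejects_def
  proof (intro allI conjI impI)
    fix x
    {
      assume "x \<in> L"
      then obtain T where T: "state (run M (std_enc x) T) = accept M"
        using dec by (auto simp: decides_def accepts_def)
      then have "halted M (run M (std_enc x) T)" by (simp add: halted_def)
      from final[OF this refl] T obtain n where "fst (?step x n) = Ready (Read ?sa)" by auto
      then show "\<exists>i. state (run ?M (wo_enc x) i) = accept ?M"
        using fm.state_run_to_tm[OF wo2] fm.to_tm_simps(4) by metis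
    next
      assume "x \<notin> L"
      then obtain T where T: "state (run M (std_enc x) T) = reject M"
        using dec by (auto simp: decides_def rejects_def)
      then have "halted M (run M (std_enc x) T)" by (simp add: halted_def)
      from final[OF this refl] T obtain n where "fst (?step x n) = Ready (Read ?sr)" by auto
      then show "\<exists>i. state (run ?M (wo_enc x) i) = reject ?M"
        using fm.state_run_to_tm[OF wo2] fm.to_tm_simps(5) by metis
    }
  qed
  moreover
  \<comment> \<open>With \<open>A = K * Z^2\<close> one has \<open>R \<le> 2 * A\<close> and
    \<open>T * (R + 1) \<le> 2 * A + Z\<close>. These contribute \<open>12 * A + 2 * Z\<close> to
    \<open>Suc P\<close>, and the remaining \<open>2 * length x + 8\<close> is at most
    \<open>10 * Z\<close>.\<close>
  obtain r where r: "\<And>n. 2 \<le> n \<Longrightarrow>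
      (12 * K + 12) * (exp_tower k (n ^ t) + n) ^ 2 \<le> exp_tower k (n ^ r)"
    using square_exp_tower_le by blast
  have "space_within ?M (wo_enc x) (exp_tower k (length x ^ r))" if x: "2 \<le> length x" for x
  proof -
    define Z where "Z = exp_tower k (length x ^ t) + length x"
    obtain T where T: "T \<le> exp_tower k (length x ^ t)" "halted M (run M (std_enc x) T)"
      using time[OF x] by (auto simp: halts_within_def)
    define R where "R = K * (length x + T + 1)"
    define P where "P = 2 * (length x + 1 + T * (R + 1) + 2 * R) + 5"
    have heads: "snd (snd (?step x j)) \<le> P" for j
      using final[OF T(2) R_def] unfolding P_def by blast
    have "length (wo_enc x) = 2 * length x"
      by (induction x) (auto simp: wo_enc_def)
    then have "cells_used ?M (wo_enc x) \<subseteq> {..P}"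
      using heads fm.head_run_to_tm[OF wo2] by (auto simp: cells_used_def P_def)
    then have "finite (cells_used ?M (wo_enc x))" "card (cells_used ?M (wo_enc x)) \<le> Suc P"
      using finite_subset card_mono[of "{..P}"] by auto
    moreover have "Suc P \<le> (12 * K + 12) * Z ^ 2"
    proof -
      have Z: "1 \<le> Z" "length x \<le> Z" "T \<le> Z" "length x + T + 1 \<le> 2 * Z"
        using x T by (auto simp: Z_def)
      then have ZZ: "Z \<le> Z * Z" by simp
      have "R \<le> K * (2 * Z)" unfolding R_def by (rule mult_le_mono2[OF Z(4)])
      also have "\<dots> = (2 * K) * Z" by simp
      finally have R: "R \<le> (2 * K) * Z" .
      have "(2 * K) * Z \<le> (2 * K) * (Z * Z)" by (rule mult_le_mono2[OF ZZ])
      with R have R2: "R \<le> (2 * K) * (Z * Z)" by linarith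
      have "T * (R + 1) \<le> Z * ((2 * K) * Z + 1)" using Z R by (intro mult_le_mono) auto
      also have "\<dots> = (2 * K) * (Z * Z) + Z" by (simp add: algebra_simps)
      finally have TR: "T * (R + 1) \<le> (2 * K) * (Z * Z) + Z" .
      define A where "A = K * (Z * Z)"
      have "R \<le> 2 * A" "T * (R + 1) \<le> 2 * A + Z" using R2 TR by (simp_all add: A_def)
      \<comment> \<open>Variables stand for the products \<open>T * (R + 1)\<close> and
        \<open>Z * Z\<close>, which makes the estimate linear.\<close>
      moreover have "Suc (2 * (n + 1 + tr + 2 * r) + 5) \<le> 12 * A + 12 * zz"
        if "r \<le> 2 * A" "tr \<le> 2 * A + Z" "1 \<le> Z" "n \<le> Z" "Z \<le> zz" for n tr r zz
        using that by simp
      ultimately have "Suc P \<le> 12 * A + 12 * (Z * Z)" using Z ZZ unfolding P_def by blast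
      also have "\<dots> = (12 * K + 12) * Z ^ 2" by (simp add: A_def power2_eq_square algebra_simps)
      finally show ?thesis .
    qed
    ultimately show ?thesis
      using r[OF x] unfolding space_within_def Z_def by linarith
  qed
  ultimately show "L \<in> DEXPWOSPACE k" using wo unfolding DEXPWOSPACE_def by blast
qed

theorem theorem2:
  fixes k :: nat
  shows "EXPTIME k = DEXPWOSPACE k"
  by (rule antisym[OF EXPTIME_subset_DEXPWOSPACE DEXPWOSPACE_subset_EXPTIME])

end
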